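(* Let $p>3$ be a prime, and let $h=h(p)$ be defined by: $h=1$ if $p\equiv 11,23\pmod{24}$; $h=2$ if $p\equiv 5\pmod{24}$; $h=3$ if $p\equiv 7,19\pmod{24}$; $h=4$ if $p\equiv 17\pmod{24}$; $h=6$ if $p\equiv 13\pmod{24}$; $h=12$ if $p\equiv 1\pmod{24}$. Let $k=hk'$ with $k'$ an integer, and let $d$ be the integer with $p-1=2hd$. Let $c$ be the smallest positive integer representative of $\frac{k'h}{12}$ modulo $d$, i.e. the smallest positive integer with $\frac{12}{h}c\equiv k'\pmod d$ (where $12/h$ is an integer coprime to $d$). 1. For $c=\frac{k(p+1)}{12}-\left\lfloor\frac{k(p+1)}{12d}\right\rfloor d$, the number of $\eta$-quotients of level $p$ in $S_k(\Gamma_1(p))$ is $\frac{k(p+1)}{12d}-1$. 2. For $c<\frac{k(p+1)}{12}-\left\lfloor\frac{k(p+1)}{12d}\right\rfloor d$, the number of $\eta$-quotients of level $p$ in $S_k(\Gamma_1(p))$ is $\left\lceil\frac{k(p+1)}{12d}\right\rceil$. 3. For $c>\frac{k(p+1)}{12}-\left\lfloor\frac{k(p+1)}{12d}\right\rfloor d$, the number of $\eta$-quotients of level $p$ in $S_k(\Gamma_1(p))$ is $\left\lfloor\frac{k(p+1)}{12d}\right\rfloor$.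
   Context: $\eta(z)=q^{1/24}\prod_{n\ge1}(1-q^n)$ with $q=e^{2\pi i z}$, for $z$ in the upper half plane. An $\eta$-quotient of level $p$ ($p$ prime) is a function $\eta(z)^{r_1}\eta(pz)^{r_p}$ with $r_1,r_p\in\mathbb Z$; its weight is $\frac12(r_1+r_p)$. $\Gamma_1(p)$ is the group of matrices in $\mathrm{SL}_2(\mathbb Z)$ congruent to $\begin{pmatrix}1&*\\0&1\end{pmatrix}$ modulo $p$, and $S_k(\Gamma_1(p))$ is the space of cusp forms of weight $k$ for $\Gamma_1(p)$.
   Formalization: k' is assumed positive (for negative k' the formulas can give negative counts), and c is the smallest nonnegative rather than positive representative, so c=0 when d divides k' (with c=d the count is wrong, e.g. p=5, k=2). *)

theory Defs
  imports "HOL-Analysis.Analysis" "HOL-Number_Theory.Number_Theory"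
begin

definition upper_half_plane :: "complex set"
  where "upper_half_plane = {z. Im z > 0}"

text \<open>The factor \<open>q\<^sup>1\<^sup>/\<^sup>2\<^sup>4\<close> stands for \<open>exp (2 \<pi> \<i> z / 24)\<close>, not for a branch of a root of \<open>q\<close>.\<close>

definition dedekind_eta :: "complex \<Rightarrow> complex"
  where "dedekind_eta z =
    exp (2 * of_real pi * \<i> * z / 24) * (\<Prod>n. 1 - exp (2 * of_real pi * \<i> * z) ^ Suc n)"

text \<open>Functions on the upper half plane are rendered as members of \<open>extensional upper_half_plane\<close>,
  so that two of them are equal in HOL iff they agree on the upper half plane.\<close>

definition eta_quotient :: "nat \<Rightarrow> int \<Rightarrow> int \<Rightarrow> complex \<Rightarrow> complex"
  where "eta_quotient p r1 rp =
    (\<lambda>z\<in>upper_half_plane. dedekind_eta z powi r1 * dedekind_eta (of_nat p * z) powi rp)"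

definition eta_quotients :: "nat \<Rightarrow> (complex \<Rightarrow> complex) set"
  where "eta_quotients p = {eta_quotient p r1 rp | r1 rp. True}"

definition SL2Z :: "(int ^ 2 ^ 2) set"
  where "SL2Z = {A. det A = 1}"

definition Gamma1 :: "nat \<Rightarrow> (int ^ 2 ^ 2) set"
  where "Gamma1 N = {A \<in> SL2Z.
    [A $ 1 $ 1 = 1] (mod int N) \<and> [A $ 2 $ 1 = 0] (mod int N) \<and> [A $ 2 $ 2 = 1] (mod int N)}"

definition moebius_act :: "int ^ 2 ^ 2 \<Rightarrow> complex \<Rightarrow> complex"
  where "moebius_act A z =
    (of_int (A $ 1 $ 1) * z + of_int (A $ 1 $ 2)) / (of_int (A $ 2 $ 1) * z + of_int (A $ 2 $ 2))"

definition slash :: "int \<Rightarrow> (complex \<Rightarrow> complex) \<Rightarrow> int ^ 2 ^ 2 \<Rightarrow> complex \<Rightarrow> complex"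
  where "slash k f A z =
    (of_int (A $ 2 $ 1) * z + of_int (A $ 2 $ 2)) powi (- k) * f (moebius_act A z)"

text \<open>Vanishing at all cusps: every \<open>SL2Z\<close>-translate of \<open>f\<close> tends to 0 as \<open>Im z \<rightarrow> \<infinity>\<close>, uniformly
  in \<open>Re z\<close>. For congruence subgroups this says that the Fourier expansion of each translate
  has positive exponents only; in particular it includes holomorphy at the cusps.\<close>

definition cusp_forms :: "int \<Rightarrow> (int ^ 2 ^ 2) set \<Rightarrow> (complex \<Rightarrow> complex) set"
  where "cusp_forms k G = {f \<in> extensional upper_half_plane.
    f holomorphic_on upper_half_plane \<and>
    (\<forall>A\<in>G. \<forall>z\<in>upper_half_plane. slash k f A z = f z) \<and>
    (\<forall>A\<in>SL2Z. (slash k f A \<longlongrightarrow> 0) (filtercomap Im at_top))}"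

text \<open>Primes greater than 3 lie in one of the eight listed classes.\<close>

definition h_of :: "nat \<Rightarrow> nat"
  where "h_of p =
    (if p mod 24 \<in> {11, 23} then 1
     else if p mod 24 = 5 then 2
     else if p mod 24 \<in> {7, 19} then 3
     else if p mod 24 = 17 then 4
     else if p mod 24 = 13 then 6
     else if p mod 24 = 1 then 12
     else undefined)"

text \<open>The representative of \<open>k' h / 12\<close> modulo \<open>d\<close>. It is 0 when \<open>d\<close> divides \<open>k'\<close>: taking \<open>d\<close>
  instead would make the \<open>\<eta>\<close>-quotient counts wrong (for \<open>p = 5\<close>, \<open>k' = 1\<close> there is no
  \<open>\<eta>\<close>-quotient in \<open>S\<^sub>2(\<Gamma>\<^sub>1(5)) = 0\<close>, but one would be predicted). The existence of a solution
  rests on \<open>12 div h\<close> being coprime to \<open>d\<close>.\<close>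

definition least_rep :: "nat \<Rightarrow> nat \<Rightarrow> int \<Rightarrow> nat"
  where "least_rep h d k' = (LEAST c. [int (12 div h) * int c = k'] (mod int d))"

lemma h_of_dvd_12_coprime:
  assumes "prime p" "p > 3" "p - 1 = 2 * h_of p * d"
  shows "h_of p dvd 12 \<and> coprime (12 div h_of p) d"
proof -
  have ndvd: "\<not> 2 dvd p" "\<not> 3 dvd p"
    using assms(1,2) by (auto simp: prime_nat_iff)
  then have cases: "p mod 24 = 1 \<or> p mod 24 = 5 \<or> p mod 24 = 7 \<or> p mod 24 = 11 \<or>
      p mod 24 = 13 \<or> p mod 24 = 17 \<or> p mod 24 = 19 \<or> p mod 24 = 23"
    by presburger
  define m where "m = p div 24"
  have p: "p = 24 * m + p mod 24" by (simp add: m_def)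
  have two: "coprime 2 d" if "\<not> 2 dvd d" using that by (simp add: prime_imp_coprime)
  have three: "coprime 3 d" if "\<not> 3 dvd d" using that by (simp add: prime_imp_coprime)
  have prods: "(4::nat) = 2 * 2" "(6::nat) = 2 * 3" "(12::nat) = 2 * (2 * 3)" by simp_all
  have four: "coprime 4 d" if "\<not> 2 dvd d"
    using two that unfolding prods coprime_mult_left_iff by blast
  have six: "coprime 6 d" if "\<not> 2 dvd d" "\<not> 3 dvd d"
    using two three that unfolding prods coprime_mult_left_iff by blast
  have twelve: "coprime 12 d" if "\<not> 2 dvd d" "\<not> 3 dvd d"
    using two three that unfolding prods coprime_mult_left_iff by blast
  from cases show ?thesis
  proof (elim disjE)
    assume r: "p mod 24 = 1"
    then show ?thesis by (simp add: h_of_def)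
  next
    assume r: "p mod 24 = 5"
    then have "d = 6 * m + 1" using assms(3) p by (simp add: h_of_def)
    then have "\<not> 2 dvd d" "\<not> 3 dvd d" by presburger+
    then show ?thesis using r six by (simp add: h_of_def)
  next
    assume r: "p mod 24 = 7"
    then have "d = 4 * m + 1" using assms(3) p by (simp add: h_of_def)
    then have "\<not> 2 dvd d" by presburger
    then show ?thesis using r four by (simp add: h_of_def)
  next
    assume r: "p mod 24 = 11"
    then have "d = 12 * m + 5" using assms(3) p by (simp add: h_of_def)
    then have "\<not> 2 dvd d" "\<not> 3 dvd d" by presburger+
    then show ?thesis using r twelve by (simp add: h_of_def)
  next
    assume r: "p mod 24 = 13"
    then have "d = 2 * m + 1" using assms(3) p by (simp add: h_of_def)
    then have "\<not> 2 dvd d" by presburger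
    then show ?thesis using r two by (simp add: h_of_def)
  next
    assume r: "p mod 24 = 17"
    then have "d = 3 * m + 2" using assms(3) p by (simp add: h_of_def)
    then have "\<not> 3 dvd d" by presburger
    then show ?thesis using r three by (simp add: h_of_def)
  next
    assume r: "p mod 24 = 19"
    then have "d = 4 * m + 3" using assms(3) p by (simp add: h_of_def)
    then have "\<not> 2 dvd d" by presburger
    then show ?thesis using r four by (simp add: h_of_def)
  next
    assume r: "p mod 24 = 23"
    then have "d = 12 * m + 11" using assms(3) p by (simp add: h_of_def)
    then have "\<not> 2 dvd d" "\<not> 3 dvd d" by presburger+
    then show ?thesis using r twelve by (simp add: h_of_def)
  qed
qed

end

theory Submission
  imports Defs "HOL-Complex_Analysis.Cauchy_Integral_Formula"
    "HOL-Computational_Algebra.Fundamental_Theorem_Algebra"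
begin

text \<open>Let \<open>F(\<tau>, z)\<close> be \<open>\<theta>\<^sub>1(z | \<tau>) / \<eta>(\<tau>)\<^sup>3\<close>, normalised by \<open>F'(\<tau>, 0) = 2 \<pi> \<i>\<close>. Liouville's theorem gives its
  behaviour under \<open>SL\<^sub>2(\<int>)\<close>, and since its weight is \<open>-1\<close> no square root occurs. The product of the
  values of \<open>F\<close> at the 2-division points is essentially \<open>\<eta>\<^sup>-\<^sup>6\<close>, so \<open>\<Delta> = \<eta>\<^sup>2\<^sup>4\<close> has weight 12. The product of
  its values at \<open>j / p\<close> for \<open>1 \<le> j \<le> (p - 1) / 2\<close> is a multiple of \<open>g(z) = \<eta>(pz) / \<eta>(z)\<^sup>p\<close>, so \<open>g\<close> has
  weight \<open>(1 - p) / 2\<close> on \<open>\<Gamma>\<^sub>1(p)\<close>, with trivial character.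

  Invariance under \<open>z \<mapsto> z + 1\<close> forces \<open>r\<^sub>1 + p r\<^sub>p = 24 n\<close>, and conversely the \<open>\<eta>\<close>-quotient is then
  \<open>\<Delta>\<^sup>n g\<^sup>r\<close> with \<open>r = r\<^sub>p\<close>, of weight \<open>k = 12 n - r (p - 1) / 2\<close>. Its orders at the cusps \<open>\<infinity>\<close> and \<open>0\<close> are \<open>n\<close>
  and \<open>N - n\<close>, where \<open>N = k (p + 1) / 12\<close>. Hence one counts the integers \<open>0 < n < N\<close> with
  \<open>n \<equiv> c (mod d)\<close>, using that \<open>N \<equiv> 2 c (mod d)\<close>.\<close>

section \<open>Infinite products\<close>

text \<open>The majorant \<open>M\<close> makes the partial products converge uniformly on a disc
  about each point, and locally uniform limits of holomorphic functions are holomorphic. The bound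
  is local with \<open>qpoch q q\<close> in view: on the whole unit disc its factors have no
  summable majorant.\<close>

lemma holomorphic_on_prodinf:
  fixes f :: "nat \<Rightarrow> complex \<Rightarrow> complex"
  assumes S: "open S" and hol: "\<And>n. f n holomorphic_on S"
    and bound: "\<And>x. x \<in> S \<Longrightarrow> \<exists>d>0. \<exists>M. cball x d \<subseteq> S \<and> summable M \<and>
      (\<forall>n. \<forall>w\<in>cball x d. norm (f n w) \<le> M n)"
  shows "(\<lambda>w. \<Prod>n. 1 + f n w) holomorphic_on S"
proof (rule holomorphic_uniform_sequence[OF S])
  show "(\<lambda>w. \<Prod>k<n. 1 + f k w) holomorphic_on S" for n
    by (intro holomorphic_intros hol)
next
  fix x assume "x \<in> S"
  then obtain d M where d: "d > 0" "cball x d \<subseteq> S" "summable M"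
    "\<And>n w. w \<in> cball x d \<Longrightarrow> norm (f n w) \<le> M n"
    using bound by metis
  have "uniformly_convergent_on (cball x d) (\<lambda>N w. \<Sum>n<N. norm (f n w))"
    by (rule Weierstrass_m_test'[OF _ d(3)]) (use d(4) in auto)
  then have "uniformly_convergent_on (cball x d) (\<lambda>N w. \<Prod>n<N. 1 + f n w)"
    by (intro uniformly_convergent_on_prod)
      (use holomorphic_on_imp_continuous_on[OF holomorphic_on_subset[OF hol d(2)]] in auto)
  then obtain g where g: "uniform_limit (cball x d) (\<lambda>N w. \<Prod>n<N. 1 + f n w) g sequentially"
    by (auto simp: uniformly_convergent_on_def)
  have "(\<Prod>n. 1 + f n w) = g w" if w: "w \<in> cball x d" for w
  proof -
    have "summable (\<lambda>n. norm (f n w))"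
      by (rule summable_comparison_test_ev[OF _ d(3)]) (use d(4)[OF w] in auto)
    then have "convergent_prod (\<lambda>n. 1 + f n w)"
      by (intro abs_convergent_prod_imp_convergent_prod) (simp add: abs_convergent_prod_conv_summable)
    then have "(\<lambda>N. \<Prod>n<N. 1 + f n w) \<longlonglongrightarrow> (\<Prod>n. 1 + f n w)"
      by (simp add: LIMSEQ_lessThan_iff_atMost convergent_prod_LIMSEQ)
    with tendsto_uniform_limitI[OF g w] show ?thesis
      using LIMSEQ_unique by blast
  qed
  then have "uniform_limit (cball x d) (\<lambda>N w. \<Prod>n<N. 1 + f n w) (\<lambda>w. \<Prod>n. 1 + f n w) sequentially"
    using g uniform_limit_cong'[of "cball x d" "\<lambda>N w. \<Prod>n<N. 1 + f n w" _ "\<lambda>w. \<Prod>n. 1 + f n w" g] by auto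
  then show "\<exists>d>0. cball x d \<subseteq> S \<and>
      uniform_limit (cball x d) (\<lambda>N w. \<Prod>n<N. 1 + f n w) (\<lambda>w. \<Prod>n. 1 + f n w) sequentially"
    using d by blast
qed

text \<open>The infinite q-Pochhammer symbol, usually written (x; q)_infinity.\<close>

definition qpoch :: "complex \<Rightarrow> complex \<Rightarrow> complex"
  where "qpoch x q = (\<Prod>n. 1 - x * q ^ n)"

lemma convergent_prod_qpoch:
  fixes x q :: complex
  assumes "norm q < 1"
  shows "convergent_prod (\<lambda>n. 1 - x * q ^ n)"
proof -
  have "summable (\<lambda>n. norm (1 - x * q ^ n - 1))"
    using assms by (simp add: norm_mult norm_power summable_mult summable_geometric)
  then show ?thesis
    by (intro abs_convergent_prod_imp_convergent_prod) (subst abs_convergent_prod_conv_summable)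
qed

lemma qpoch_rec:
  assumes "norm q < 1"
  shows "qpoch x q = (1 - x) * qpoch (x * q) q"
proof (cases "x = 1")
  case True
  then show ?thesis
    using has_prod_zeroI[OF convergent_prod_has_prod[OF convergent_prod_qpoch[OF assms, of x]], of 0]
    by (simp add: qpoch_def)
next
  case False
  then show ?thesis
    using prodinf_split_head[OF convergent_prod_qpoch[OF assms, of x]]
    by (simp add: qpoch_def mult_ac)
qed

lemma qpoch_eq_0_iff:
  assumes "norm q < 1"
  shows "qpoch x q = 0 \<longleftrightarrow> (\<exists>n. x * q ^ n = 1)"
proof -
  have "(\<lambda>n. 1 - x * q ^ n) has_prod qpoch x q"
    unfolding qpoch_def using convergent_prod_qpoch[OF assms] by blast
  then show ?thesis
    by (subst has_prod_eq_0_iff) auto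
qed

lemma qpoch_self_nonzero:
  assumes "norm q < 1"
  shows "qpoch q q \<noteq> 0"
proof
  assume "qpoch q q = 0"
  then obtain n where "q ^ Suc n = 1"
    using qpoch_eq_0_iff[OF assms] by auto
  moreover have "norm (q ^ Suc n) < 1"
    unfolding norm_power using assms power_Suc_less_one[of "norm q" n]
    by (cases "norm q = 0") auto
  ultimately show False by simp
qed

lemma holomorphic_on_qpoch [holomorphic_intros]:
  assumes "norm q < 1" "f holomorphic_on S"
  shows "(\<lambda>x. qpoch (f x) q) holomorphic_on S"
proof -
  have "(\<lambda>x. \<Prod>n. 1 + (- (x * q ^ n))) holomorphic_on UNIV"
  proof (rule holomorphic_on_prodinf)
    fix x :: complex
    have "norm (- (w * q ^ n)) \<le> (norm x + 1) * norm q ^ n" if "w \<in> cball x 1" for w n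
      using that norm_triangle_ineq2[of w x]
      by (auto simp: norm_mult norm_power dist_norm norm_minus_commute intro!: mult_right_mono)
    moreover have "summable (\<lambda>n. (norm x + 1) * norm q ^ n)"
      using assms(1) by (intro summable_mult summable_geometric) auto
    ultimately show "\<exists>d>0. \<exists>M. cball x d \<subseteq> UNIV \<and> summable M \<and>
        (\<forall>n. \<forall>w\<in>cball x d. norm (- (w * q ^ n)) \<le> M n)"
      by (intro exI[of _ 1] conjI exI[of _ "\<lambda>n. (norm x + 1) * norm q ^ n"]) auto
  qed (auto intro!: holomorphic_intros)
  then have "(\<lambda>x. qpoch x q) holomorphic_on UNIV"
    by (simp add: qpoch_def)
  from holomorphic_on_compose_gen[OF assms(2) this] show ?thesis
    by (simp add: o_def)
qed

lemma holomorphic_on_qpoch_self: "(\<lambda>q. qpoch q q) holomorphic_on ball 0 1"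
proof -
  have "(\<lambda>q::complex. \<Prod>n. 1 + (- (q * q ^ n))) holomorphic_on ball 0 1"
  proof (rule holomorphic_on_prodinf)
    fix x :: complex assume x: "x \<in> ball 0 1"
    define d where "d = (1 - norm x) / 2"
    have d: "d > 0" "norm x + d < 1" using x by (auto simp: d_def field_simps)
    have le: "norm w \<le> norm x + d" if "w \<in> cball x d" for w
      using that norm_triangle_ineq2[of w x] by (auto simp: dist_norm norm_minus_commute)
    have "norm (- (w * w ^ n)) \<le> (norm x + d) ^ n" if "w \<in> cball x d" for w n
    proof -
      have "norm w * norm w ^ n \<le> 1 * (norm x + d) ^ n"
        using le[OF that] d by (intro mult_mono power_mono) auto
      then show ?thesis by (simp add: norm_mult norm_power)
    qed
    moreover have "summable (\<lambda>n. (norm x + d) ^ n)"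
      using d by (intro summable_geometric) auto
    moreover have "cball x d \<subseteq> ball 0 1"
      using le d by fastforce
    ultimately show "\<exists>d>0. \<exists>M. cball x d \<subseteq> ball 0 1 \<and> summable M \<and>
        (\<forall>n. \<forall>w\<in>cball x d. norm (- (w * w ^ n)) \<le> M n)"
      using d(1) by blast
  qed (auto intro!: holomorphic_intros)
  then show ?thesis by (simp add: qpoch_def)
qed

text \<open>The factors of even and of odd index are separated. Partial products of length
  \<open>2 * N\<close> split exactly, and the limit is taken along this subsequence.\<close>

lemma qpoch_base_square:
  assumes "norm q < 1"
  shows "qpoch x q = qpoch x (q\<^sup>2) * qpoch (x * q) (q\<^sup>2)"
proof -
  have q2: "norm (q\<^sup>2) < 1"
    using assms by (simp add: norm_power power_less_one_iff)
  have lim: "(\<lambda>N. \<Prod>n<N. 1 - y * r ^ n) \<longlonglongrightarrow> qpoch y r" if "norm r < 1" for y r :: complex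
    unfolding qpoch_def using convergent_prod_LIMSEQ[OF convergent_prod_qpoch[OF that]]
    by (simp add: LIMSEQ_lessThan_iff_atMost)
  have "(\<Prod>n<2*N. 1 - x * q ^ n) = (\<Prod>n<N. 1 - x * (q\<^sup>2) ^ n) * (\<Prod>n<N. 1 - x * q * (q\<^sup>2) ^ n)" for N
    by (induction N) (auto simp: power_mult[symmetric] mult_ac)
  moreover have "(\<lambda>N. \<Prod>n<2*N. 1 - x * q ^ n) \<longlonglongrightarrow> qpoch x q"
    using LIMSEQ_subseq_LIMSEQ[OF lim[OF assms], of "\<lambda>N. 2 * N"]
    by (auto simp: o_def strict_mono_def)
  ultimately show ?thesis
    using tendsto_mult[OF lim[OF q2, of x] lim[OF q2, of "x * q"]] LIMSEQ_unique by force
qed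

lemma qpoch_minus:
  assumes "norm q < 1"
  shows "qpoch x q * qpoch (- x) q = qpoch (x\<^sup>2) (q\<^sup>2)"
  unfolding qpoch_def prodinf_mult[OF convergent_prod_qpoch[OF assms] convergent_prod_qpoch[OF assms]]
  by (simp add: algebra_simps power2_eq_square power_mult_distrib)

text \<open>The polynomial X^p - 1 is squarefree, hence the product of its linear factors.
  Evaluation at \<open>1 / y\<close> and multiplication by \<open>y ^ p\<close> give the claim,
  which is why \<open>y = 0\<close> is treated apart.\<close>

lemma prod_one_minus_roots_unity:
  fixes y :: complex
  assumes "p > 0"
  shows "(\<Prod>j<p. 1 - cis (2 * pi * real j / real p) * y) = 1 - y ^ p"
proof (cases "y = 0")
  case True then show ?thesis using assms by simp
next
  case False
  define w where "w = (\<lambda>j. cis (2 * pi * real j / real p))"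
  define P :: "complex poly" where "P = Polynomial.monom 1 p - 1"
  have deg: "degree P = p" "lead_coeff P = 1"
  proof -
    show "degree P = p" unfolding P_def using assms
      by (subst diff_conv_add_uminus, subst degree_add_eq_left) (auto simp: degree_monom_eq)
    then show "lead_coeff P = 1" using assms by (simp add: P_def)
  qed
  have "rsquarefree P"
    unfolding rsquarefree_roots P_def using assms
    by (auto simp: poly_monom pderiv_diff pderiv_monom power_0_left split: if_splits)
  then have P: "(\<Prod>z|poly P z = 0. [:-z, 1:]) = P"
    using complex_poly_decompose_rsquarefree[of P] deg by simp
  have "(\<Prod>z|poly P z = 0. [:-z, 1:]) = (\<Prod>j<p. [:- w j, 1:])"
    using Complex.bij_betw_roots_unity[OF assms]
    by (intro prod.reindex_bij_betw[symmetric]) (simp add: P_def poly_monom w_def)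
  with P have "poly (\<Prod>j<p. [:- w j, 1:]) (1 / y) = poly P (1 / y)" by simp
  then have "(\<Prod>j<p. 1 / y - w j) = (1 / y) ^ p - 1"
    by (simp add: poly_prod P_def poly_monom)
  moreover have "(\<Prod>j<p. 1 - w j * y) = y ^ p * (\<Prod>j<p. 1 / y - w j)"
    using False prod.distrib[of "\<lambda>_. y" "\<lambda>j. 1 / y - w j" "{..<p}"] by (simp add: algebra_simps)
  ultimately have "(\<Prod>j<p. 1 - w j * y) = y ^ p * ((1 / y) ^ p - 1)" by simp
  also have "\<dots> = 1 - y ^ p"
    using False by (simp add: algebra_simps power_divide)
  finally show ?thesis by (simp add: w_def)
qed

section \<open>The theta function modulo its eta factor\<close>

definition e2pi :: "complex \<Rightarrow> complex"
  where "e2pi z = exp (2 * of_real pi * \<i> * z)"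

lemma e2pi_0 [simp]: "e2pi 0 = 1"
  by (simp add: e2pi_def)

lemma e2pi_nonzero [simp]: "e2pi z \<noteq> 0"
  by (simp add: e2pi_def)

lemma e2pi_add: "e2pi (x + y) = e2pi x * e2pi y"
  by (simp add: e2pi_def exp_add ring_distribs)

lemma e2pi_diff: "e2pi (x - y) = e2pi x / e2pi y"
  by (simp add: e2pi_def exp_diff ring_distribs)

lemma e2pi_minus: "e2pi (- x) = inverse (e2pi x)"
  by (simp add: e2pi_def exp_minus)

lemma e2pi_of_nat_mult: "e2pi (of_nat n * z) = e2pi z ^ n"
  by (simp add: e2pi_def exp_of_nat_mult[symmetric] mult_ac)

lemma e2pi_sum: "finite I \<Longrightarrow> e2pi (\<Sum>i\<in>I. f i) = (\<Prod>i\<in>I. e2pi (f i))"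
  by (induction I rule: finite_induct) (auto simp: e2pi_add)

lemma e2pi_eq_1_iff: "e2pi z = 1 \<longleftrightarrow> z \<in> \<int>"
proof -
  have "e2pi z = 1 \<longleftrightarrow> (\<exists>n::int. 2 * of_real pi * \<i> * z = of_int (2 * n) * of_real pi * \<i>)"
    unfolding e2pi_def using exp_eq[of "2 * of_real pi * \<i> * z" 0] by simp
  also have "\<dots> \<longleftrightarrow> (\<exists>n::int. z = of_int n)"
    by (simp add: mult_ac)
  finally show ?thesis by (auto simp: Ints_def)
qed

lemma e2pi_of_int [simp]: "e2pi (of_int n) = 1"
  by (simp add: e2pi_eq_1_iff)

lemma e2pi_of_nat [simp]: "e2pi (of_nat n) = 1"
  by (simp add: e2pi_eq_1_iff)

lemma e2pi_1 [simp]: "e2pi 1 = 1"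
  using e2pi_of_nat[of 1] by simp

lemma e2pi_half [simp]: "e2pi (1 / 2) = -1"
  by (simp add: e2pi_def)

lemma norm_e2pi: "norm (e2pi z) = exp (- (2 * pi * Im z))"
  by (simp add: e2pi_def)

lemma norm_e2pi_less_1: "Im z > 0 \<Longrightarrow> norm (e2pi z) < 1"
  by (simp add: norm_e2pi)

lemma holomorphic_on_e2pi [holomorphic_intros]:
  "f holomorphic_on S \<Longrightarrow> (\<lambda>z. e2pi (f z)) holomorphic_on S"
  unfolding e2pi_def by (intro holomorphic_intros)

lemma e2pi_eqI: "x - y \<in> \<int> \<Longrightarrow> e2pi x = e2pi y"
  using e2pi_eq_1_iff[of "x - y"] by (simp add: e2pi_diff)

text \<open>The function \<open>F(\<tau>, z)\<close>, by the Jacobi triple product.\<close>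

definition siegel_prod :: "complex \<Rightarrow> complex \<Rightarrow> complex"
  where "siegel_prod \<tau> z = 2 * \<i> * sin (of_real pi * z) *
    qpoch (e2pi z * e2pi \<tau>) (e2pi \<tau>) * qpoch (inverse (e2pi z) * e2pi \<tau>) (e2pi \<tau>) /
    qpoch (e2pi \<tau>) (e2pi \<tau>) ^ 2"

lemma two_i_sin_pi: "2 * \<i> * sin (of_real pi * z) = e2pi (z / 2) - inverse (e2pi (z / 2))"
  by (simp add: sin_exp_eq e2pi_def exp_minus field_simps)

lemma siegel_prod_plus_1: "siegel_prod \<tau> (z + 1) = - siegel_prod \<tau> z"
  by (simp add: siegel_prod_def e2pi_add ring_distribs sin_add)

text \<open>Under the shift the first infinite product loses its leading factor and the second gains
  one; together with the sine factor they leave a monomial. The half arguments in \<open>u\<close>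
  and \<open>s\<close> make the sine factor rational too.\<close>

lemma siegel_prod_plus_tau:
  assumes "Im \<tau> > 0"
  shows "siegel_prod \<tau> (z + \<tau>) = - e2pi (- \<tau> / 2 - z) * siegel_prod \<tau> z"
proof -
  define u s where "u = e2pi (z / 2)" and "s = e2pi (\<tau> / 2)"
  have [simp]: "u \<noteq> 0" "s \<noteq> 0" by (auto simp: u_def s_def)
  have x: "e2pi z = u ^ 2" and q: "e2pi \<tau> = s ^ 2"
    by (simp_all add: u_def s_def e2pi_add[symmetric] power2_eq_square)
  have us: "e2pi ((z + \<tau>) / 2) = u * s"
    by (simp add: u_def s_def e2pi_add[symmetric] add_divide_distrib)
  have norm: "norm (s ^ 2) < 1"
    using norm_e2pi_less_1[OF assms] q by simp
  have m: "e2pi (- \<tau> / 2 - z) = inverse (u ^ 2 * s)"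
    using x e2pi_minus[of "\<tau> / 2 + z"] by (simp add: e2pi_add s_def mult_ac)
  have 1: "qpoch (u^2 * s^2) (s^2) = (1 - u^2 * s^2) * qpoch (u^2 * s^2 * s^2) (s^2)"
    by (rule qpoch_rec[OF norm])
  have 2: "qpoch (inverse (u^2)) (s^2) = (1 - inverse (u^2)) * qpoch (inverse (u^2) * s^2) (s^2)"
    by (rule qpoch_rec[OF norm])
  define A B C where "A = qpoch (u^2 * s^2 * s^2) (s^2)" and "B = qpoch (inverse (u^2) * s^2) (s^2)"
    and "C = qpoch (s^2) (s^2)"
  have "C \<noteq> 0" using qpoch_self_nonzero[OF norm] by (simp add: C_def)
  have 3: "inverse (u^2 * s^2) * s^2 = inverse (u^2)"
    by (simp add: field_simps)
  show ?thesis
    unfolding siegel_prod_def two_i_sin_pi us m e2pi_add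
    unfolding x q u_def[symmetric]
    unfolding 3 1 2 A_def[symmetric] B_def[symmetric] C_def[symmetric]
    using \<open>C \<noteq> 0\<close> by (simp add: field_simps power2_eq_square)
qed

text \<open>The sign (-1)^(m + n) is written as an exponential, so that the multiplier is a single
  value of \<open>e2pi\<close>. Its quadratic term in \<open>n\<close> is the sum of the linear
  exponents met in successive shifts by \<open>\<tau>\<close>.\<close>

lemma siegel_prod_lattice:
  assumes "Im \<tau> > 0"
  shows "siegel_prod \<tau> (z + of_int m + of_int n * \<tau>) =
    e2pi ((of_int m + of_int n) / 2 - of_int n ^ 2 * \<tau> / 2 - of_int n * z) * siegel_prod \<tau> z"
proof -
  have one: "siegel_prod \<tau> (z + of_int m) = e2pi (of_int m / 2) * siegel_prod \<tau> z" for z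
  proof (induction m rule: int_induct[where k = 0])
    case (step1 i)
    then show ?case
      using siegel_prod_plus_1[of \<tau> "z + of_int i"] by (simp add: add_ac e2pi_add add_divide_distrib)
  next
    case (step2 i)
    then show ?case
      using siegel_prod_plus_1[of \<tau> "z + of_int (i - 1)"]
      by (simp add: add_ac e2pi_diff diff_divide_distrib)
  qed simp
  have tau: "siegel_prod \<tau> (z + of_int n * \<tau>) =
    e2pi (of_int n / 2 - of_int n ^ 2 * \<tau> / 2 - of_int n * z) * siegel_prod \<tau> z" for z
  proof (induction n rule: int_induct[where k = 0])
    case (step1 i)
    have "siegel_prod \<tau> (z + of_int (i + 1) * \<tau>) =
        - e2pi (- \<tau> / 2 - (z + of_int i * \<tau>)) *
        (e2pi (of_int i / 2 - of_int i ^ 2 * \<tau> / 2 - of_int i * z) * siegel_prod \<tau> z)"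
      using siegel_prod_plus_tau[OF assms, of "z + of_int i * \<tau>"] step1
      by (simp add: algebra_simps)
    also have "\<dots> = e2pi (1 / 2 + (- \<tau> / 2 - (z + of_int i * \<tau>)) +
        (of_int i / 2 - of_int i ^ 2 * \<tau> / 2 - of_int i * z)) * siegel_prod \<tau> z"
      unfolding e2pi_add by simp
    also have "1 / 2 + (- \<tau> / 2 - (z + of_int i * \<tau>)) +
        (of_int i / 2 - of_int i ^ 2 * \<tau> / 2 - of_int i * z) =
        of_int (i + 1) / 2 - of_int (i + 1) ^ 2 * \<tau> / 2 - of_int (i + 1) * z"
      by (simp add: field_simps power2_eq_square)
    finally show ?case .
  next
    case (step2 i)
    have "- e2pi (- \<tau> / 2 - (z + of_int (i - 1) * \<tau>)) * siegel_prod \<tau> (z + of_int (i - 1) * \<tau>) =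
        e2pi (of_int i / 2 - of_int i ^ 2 * \<tau> / 2 - of_int i * z) * siegel_prod \<tau> z"
      using siegel_prod_plus_tau[OF assms, of "z + of_int (i - 1) * \<tau>"] step2
      by (simp add: algebra_simps)
    also have "of_int i / 2 - of_int i ^ 2 * \<tau> / 2 - of_int i * z =
        1 / 2 + (- \<tau> / 2 - (z + of_int (i - 1) * \<tau>)) +
        (of_int (i - 1) / 2 - of_int (i - 1) ^ 2 * \<tau> / 2 - of_int (i - 1) * z)"
      by (simp add: field_simps power2_eq_square)
    finally show ?case
      unfolding e2pi_add[of "1 / 2 + _"] e2pi_add[of "1 / 2"] by simp
  qed simp
  have "siegel_prod \<tau> (z + of_int m + of_int n * \<tau>) =
    e2pi (of_int n / 2 - of_int n ^ 2 * \<tau> / 2 - of_int n * (z + of_int m) + of_int m / 2) * siegel_prod \<tau> z"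
    unfolding tau one e2pi_add[of _ "of_int m / 2"] by simp
  \<comment> \<open>Carrying out the integral shift first changes the exponent by the integer
    \<open>- n * m\<close>, which \<open>e2pi\<close> does not see.\<close>
  also have "e2pi (of_int n / 2 - of_int n ^ 2 * \<tau> / 2 - of_int n * (z + of_int m) + of_int m / 2) =
    e2pi ((of_int m + of_int n) / 2 - of_int n ^ 2 * \<tau> / 2 - of_int n * z)"
  proof (rule e2pi_eqI)
    have "of_int n / 2 - of_int n ^ 2 * \<tau> / 2 - of_int n * (z + of_int m) + of_int m / 2 -
      ((of_int m + of_int n) / 2 - of_int n ^ 2 * \<tau> / 2 - of_int n * z) = of_int (- n * m)"
      by (simp add: field_simps)
    then show "of_int n / 2 - of_int n ^ 2 * \<tau> / 2 - of_int n * (z + of_int m) + of_int m / 2 -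
      ((of_int m + of_int n) / 2 - of_int n ^ 2 * \<tau> / 2 - of_int n * z) \<in> \<int>"
      by (metis Ints_of_int)
  qed
  finally show ?thesis .
qed

lemma holomorphic_on_siegel_prod [holomorphic_intros]:
  assumes "Im \<tau> > 0" "f holomorphic_on S"
  shows "(\<lambda>z. siegel_prod \<tau> (f z)) holomorphic_on S"
  unfolding siegel_prod_def
  using norm_e2pi_less_1[OF assms(1)] qpoch_self_nonzero
  by (intro holomorphic_intros assms) auto

text \<open>The sine vanishes at the lattice points with \<open>n = 0\<close>, the first infinite
  product at points with \<open>n < 0\<close>, the second at points with
  \<open>n > 0\<close>.\<close>

lemma siegel_prod_eq_0D:
  assumes "Im \<tau> > 0" "siegel_prod \<tau> z = 0"
  shows "\<exists>m n::int. z = of_int m + of_int n * \<tau>"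
proof -
  let ?q = "e2pi \<tau>"
  have q: "norm ?q < 1" by (rule norm_e2pi_less_1) fact
  consider "sin (of_real pi * z) = 0" | "qpoch (e2pi z * ?q) ?q = 0"
    | "qpoch (inverse (e2pi z) * ?q) ?q = 0"
    using assms(2) qpoch_self_nonzero[OF q] by (auto simp: siegel_prod_def)
  then show ?thesis
  proof cases
    case 1
    then obtain n :: int where "of_real pi * z = of_real (of_int n * pi)"
      by (auto simp: sin_eq_0)
    then have "z = of_int n" by simp
    then show ?thesis by (intro exI[of _ n] exI[of _ 0]) simp
  next
    case 2
    then obtain n where "e2pi z * ?q * ?q ^ n = 1"
      by (auto simp: qpoch_eq_0_iff[OF q])
    then have "e2pi (z + of_nat (Suc n) * \<tau>) = 1"
      by (simp only: e2pi_add e2pi_of_nat_mult) (simp add: mult_ac)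
    then obtain m where "z + of_nat (Suc n) * \<tau> = of_int m"
      by (auto simp: e2pi_eq_1_iff elim: Ints_cases)
    then show ?thesis
      by (intro exI[of _ m] exI[of _ "- int (Suc n)"]) (simp add: algebra_simps eq_diff_eq)
  next
    case 3
    then obtain n where "inverse (e2pi z) * ?q * ?q ^ n = 1"
      by (auto simp: qpoch_eq_0_iff[OF q])
    then have "e2pi (- z + of_nat (Suc n) * \<tau>) = 1"
      by (simp only: e2pi_add e2pi_of_nat_mult e2pi_minus) (simp add: mult_ac)
    then obtain m where "- z + of_nat (Suc n) * \<tau> = of_int m"
      by (auto simp: e2pi_eq_1_iff elim: Ints_cases)
    then show ?thesis
      by (intro exI[of _ "- m"] exI[of _ "int (Suc n)"]) (simp add: algebra_simps eq_diff_eq)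
  qed
qed

lemma siegel_prod_0 [simp]: "siegel_prod \<tau> 0 = 0"
  by (simp add: siegel_prod_def)

text \<open>The sine contributes the derivative, and the division by the square of
  \<open>qpoch ?q ?q\<close> gives the remaining factor \<open>W\<close> the value 1 at 0. The
  result is the same for all \<open>\<tau>\<close>, so functions for different \<open>\<tau>\<close>
  can be compared at 0.\<close>

lemma siegel_prod_deriv_0:
  assumes "Im \<tau> > 0"
  shows "(siegel_prod \<tau> has_field_derivative 2 * of_real pi * \<i>) (at 0)"
proof -
  let ?q = "e2pi \<tau>"
  define W where "W = (\<lambda>z. qpoch (e2pi z * ?q) ?q * qpoch (e2pi (- z) * ?q) ?q / qpoch ?q ?q ^ 2)"
  have q: "norm ?q < 1" "qpoch ?q ?q \<noteq> 0"
    using norm_e2pi_less_1[OF assms] qpoch_self_nonzero by auto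
  have "W holomorphic_on UNIV"
    unfolding W_def by (intro holomorphic_intros q) (use q in auto)
  then have "(W has_field_derivative deriv W 0) (at 0)"
    by (intro holomorphic_derivI[of W UNIV]) auto
  moreover have "W 0 = 1"
    by (simp add: W_def power2_eq_square q(2))
  ultimately have "((\<lambda>z. 2 * \<i> * sin (of_real pi * z) * W z) has_field_derivative
      2 * of_real pi * \<i>) (at 0)"
    by (auto intro!: derivative_eq_intros)
  moreover have "siegel_prod \<tau> = (\<lambda>z. 2 * \<i> * sin (of_real pi * z) * W z)"
    by (auto simp: siegel_prod_def W_def e2pi_minus)
  ultimately show ?thesis by simp
qed

section \<open>Modular transformation of the theta function\<close>

text \<open>Modulo the lattice each point lies in the compact parallelogram \<open>K\<close>;
  \<open>s\<close> and \<open>t\<close> are its real coordinates with respect to 1 and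
  \<open>\<tau>\<close>, reduced by \<open>frac\<close>.\<close>

lemma doubly_periodic_imp_bounded:
  fixes H :: "complex \<Rightarrow> complex"
  assumes \<tau>: "Im \<tau> > 0" and cont: "continuous_on UNIV H"
    and per: "\<And>z m n. H (z + of_int m + of_int n * \<tau>) = H z"
  shows "bounded (range H)"
proof -
  define K where "K = (\<lambda>(s, t). of_real s + of_real t * \<tau>) ` (cbox (0, 0) (1, 1) :: (real \<times> real) set)"
  have "compact K"
    unfolding K_def case_prod_unfold by (intro compact_continuous_image continuous_intros compact_cbox)
  then have "bounded (H ` K)"
    by (intro compact_imp_bounded compact_continuous_image continuous_on_subset[OF cont]) auto
  moreover have "range H \<subseteq> H ` K"
  proof safe
    fix z
    define t where "t = Im z / Im \<tau>"
    define s where "s = Re z - t * Re \<tau>"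
    have z: "z = of_real s + of_real t * \<tau>"
      using \<tau> by (auto simp: complex_eq_iff s_def t_def)
    have "of_real (frac s) + of_real (frac t) * \<tau> + of_int \<lfloor>s\<rfloor> + of_int \<lfloor>t\<rfloor> * \<tau> = z"
      unfolding z frac_def by (simp add: algebra_simps)
    then have "H z = H (of_real (frac s) + of_real (frac t) * \<tau>)"
      using per[of "of_real (frac s) + of_real (frac t) * \<tau>" "\<lfloor>s\<rfloor>" "\<lfloor>t\<rfloor>"] by simp
    moreover have "of_real (frac s) + of_real (frac t) * \<tau> \<in> K"
      unfolding K_def by (rule image_eqI[of _ _ "(frac s, frac t)"])
        (auto simp: frac_ge_0 frac_lt_1[THEN less_imp_le])
    ultimately show "H z \<in> H ` K" by blast
  qed
  ultimately show ?thesis by (rule bounded_subset)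
qed

text \<open>Liouville's theorem applied to the quotient of two functions with the same multipliers.\<close>

lemma quasiperiodic_unique:
  fixes N D :: "complex \<Rightarrow> complex"
  assumes \<tau>: "Im \<tau> > 0"
    and hol: "N holomorphic_on UNIV" "D holomorphic_on UNIV"
    and N0: "N 0 = 0" "(N has_field_derivative a) (at 0)"
    and D0: "D 0 = 0" "(D has_field_derivative a) (at 0)" and a: "a \<noteq> 0"
    and zeros: "\<And>z. D z = 0 \<Longrightarrow> \<exists>m n::int. z = of_int m + of_int n * \<tau>"
    and mult: "\<And>z m n. \<mu> m n z \<noteq> 0"
    and qN: "\<And>z m n. N (z + of_int m + of_int n * \<tau>) = \<mu> m n z * N z"
    and qD: "\<And>z m n. D (z + of_int m + of_int n * \<tau>) = \<mu> m n z * D z"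
  shows "N z = D z"
proof -
  \<comment> \<open>The value 1 at the zeros of \<open>D\<close> is the limit of
    \<open>N z / D z\<close> at 0, where both functions have derivative \<open>a\<close>. It makes
    \<open>H\<close> continuous at 0, and periodicity transfers this to the other zeros.\<close>
  define H where "H = (\<lambda>z. if D z = 0 then 1 else N z / D z)"
  have per: "H (z + of_int m + of_int n * \<tau>) = H z" for z m n
    using mult[of m n z] by (simp add: H_def qN qD)
  have lim: "((\<lambda>z. N z / z) \<longlongrightarrow> a) (at 0)" "((\<lambda>z. D z / z) \<longlongrightarrow> a) (at 0)"
    using N0 D0 by (auto simp: has_field_derivative_iff)
  have ev: "eventually (\<lambda>z. D z \<noteq> 0 \<and> z \<noteq> 0) (at 0)"
    using tendsto_imp_eventually_ne[OF lim(2) a] eventually_neq_at_within[of 0]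
    by eventually_elim auto
  have H0: "(H \<longlongrightarrow> H 0) (at 0)"
  proof -
    have "((\<lambda>z. (N z / z) / (D z / z)) \<longlongrightarrow> a / a) (at 0)"
      by (intro tendsto_intros lim a)
    moreover have "eventually (\<lambda>z. (N z / z) / (D z / z) = H z) (at 0)"
      using ev by eventually_elim (auto simp: H_def)
    ultimately show ?thesis
      using a D0(1) by (auto simp: H_def dest: tendsto_cong)
  qed
  have diff0: "H field_differentiable at w" if "D w \<noteq> 0" for w
  proof -
    define S where "S = {z. D z \<noteq> 0}"
    have "open S"
    proof -
      have "S = D -` (- {0})" by (auto simp: S_def)
      then show ?thesis
        using open_vimage[of "- {0}" D] holomorphic_on_imp_continuous_on[OF hol(2)] by auto
    qed
    moreover have "(\<lambda>z. N z / D z) holomorphic_on S"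
      by (intro holomorphic_intros holomorphic_on_subset[OF hol(1)] holomorphic_on_subset[OF hol(2)])
        (auto simp: S_def)
    then have "H holomorphic_on S"
      by (rule holomorphic_transform) (auto simp: H_def S_def)
    ultimately show ?thesis
      using that by (auto intro: holomorphic_on_imp_differentiable_at simp: S_def)
  qed
  have diff1: "H field_differentiable at 0"
  proof -
    obtain e where e: "e > 0" "\<And>z. z \<in> ball 0 e - {0} \<Longrightarrow> D z \<noteq> 0"
      using ev unfolding eventually_at by (auto simp: dist_norm)
    have "H holomorphic_on ball 0 e"
    proof (rule no_isolated_singularity')
      show "(H \<longlongrightarrow> H z) (at z within ball 0 e)" if "z \<in> {0}" for z
        using that H0 by (auto intro: tendsto_within_subset)
      show "H holomorphic_on ball 0 e - {0}"
        using diff0 e(2) by (auto simp: holomorphic_on_def intro: field_differentiable_at_within)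
    qed auto
    then show ?thesis
      using e(1) by (intro holomorphic_on_imp_differentiable_at[of H "ball 0 e"]) auto
  qed
  have diff: "H field_differentiable at w" for w
  proof (cases "D w = 0")
    case False then show ?thesis by (rule diff0)
  next
    case True
    then obtain m n :: int where w: "w = of_int m + of_int n * \<tau>" using zeros by blast
    have "H = H \<circ> (\<lambda>z. z - w)"
    proof
      fix z show "H z = (H \<circ> (\<lambda>z. z - w)) z"
        using per[of "z - w" m n] by (simp add: w algebra_simps)
    qed
    moreover have "(H \<circ> (\<lambda>z. z - w)) field_differentiable at w"
      using diff1 by (intro field_differentiable_compose derivative_intros) auto
    ultimately show ?thesis by simp
  qed
  have hol_H: "H holomorphic_on UNIV"
    using diff by (auto simp: holomorphic_on_def)
  have "bounded (range H)"
    using doubly_periodic_imp_bounded[of \<tau> H] \<tau> holomorphic_on_imp_continuous_on[OF hol_H] per by blast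
  from Liouville_theorem[OF hol_H this] obtain c where "\<And>z. H z = c"
    by (auto simp: constant_on_def)
  then have H: "H z = 1" for z
    using D0(1) by (metis H_def)
  show ?thesis
  proof (cases "D z = 0")
    case True
    then obtain m n :: int where "z = of_int m + of_int n * \<tau>" using zeros by blast
    then show ?thesis using qN[of 0 m n] qD[of 0 m n] N0 D0 by simp
  next
    case False
    then show ?thesis using H[of z] by (simp add: H_def)
  qed
qed

lemma moebius_denom_nonzero:
  fixes a b c d :: int
  assumes "a * d - b * c = 1" "Im \<tau> > 0"
  shows "of_int c * \<tau> + of_int d \<noteq> (0::complex)"
proof
  assume *: "of_int c * \<tau> + of_int d = 0"
  then have "Im (of_int c * \<tau> + of_int d) = 0" by simp
  then have "c = 0" using assms(2) by simp
  with * assms(1) show False by simp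
qed

lemma Im_moebius:
  fixes a b c d :: int
  assumes "a * d - b * c = 1" "Im \<tau> > 0"
  shows "Im ((of_int a * \<tau> + of_int b) / (of_int c * \<tau> + of_int d)) =
    Im \<tau> / norm (of_int c * \<tau> + of_int d) ^ 2"
proof -
  have det: "real_of_int a * real_of_int d - real_of_int b * real_of_int c = 1"
    using assms(1) by (metis of_int_1 of_int_diff of_int_mult)
  have "Im ((of_int a * \<tau> + of_int b) * cnj (of_int c * \<tau> + of_int d)) =
      Im \<tau> * (real_of_int a * real_of_int d - real_of_int b * real_of_int c)"
    by (simp add: algebra_simps)
  then show ?thesis
    unfolding complex_div_cnj[of "of_int a * \<tau> + of_int b"] det
    by (simp only: of_real_power[symmetric] Im_divide_of_real)
qed

lemma Im_moebius_pos:
  fixes a b c d :: int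
  assumes "a * d - b * c = 1" "Im \<tau> > 0"
  shows "Im ((of_int a * \<tau> + of_int b) / (of_int c * \<tau> + of_int d)) > 0"
  using Im_moebius[OF assms] moebius_denom_nonzero[OF assms] assms(2) by simp

text \<open>Moving the exponential and \<open>J\<close> to the left-hand side yields the function
  \<open>N\<close>. The exponential turns the multipliers for the lattice of \<open>\<tau>'\<close>
  into those for \<open>\<tau>\<close>, and the factor \<open>J\<close> restores the derivative at
  0, so \<open>quasiperiodic_unique\<close> applies.\<close>

theorem siegel_prod_moebius:
  fixes a b c d :: int
  assumes det: "a * d - b * c = 1" and \<tau>: "Im \<tau> > 0"
  defines "J \<equiv> of_int c * \<tau> + of_int d"
  defines "\<tau>' \<equiv> (of_int a * \<tau> + of_int b) / J"
  shows "siegel_prod \<tau>' (z / J) = e2pi (of_int c * z ^ 2 / (2 * J)) / J * siegel_prod \<tau> z"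
proof -
  have J: "J \<noteq> 0" and \<tau>': "Im \<tau>' > 0"
    unfolding J_def \<tau>'_def using moebius_denom_nonzero[OF det \<tau>] Im_moebius_pos[OF det \<tau>] by auto
  have detc: "of_int a * of_int d - of_int b * of_int c = (1::complex)"
    using det by (metis of_int_1 of_int_diff of_int_mult)
  define N where "N = (\<lambda>z. J * e2pi (- (of_int c * z ^ 2 / (2 * J))) * siegel_prod \<tau>' (z / J))"
  have "N z = siegel_prod \<tau> z"
  proof (rule quasiperiodic_unique[OF \<tau>, where N = N and D = "siegel_prod \<tau>" and a = "2 * of_real pi * \<i>" and
        \<mu> = "\<lambda>m n z. e2pi ((of_int m + of_int n) / 2 - of_int n ^ 2 * \<tau> / 2 - of_int n * z)"])
    show "N holomorphic_on UNIV" "siegel_prod \<tau> holomorphic_on UNIV"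
      unfolding N_def using J by (auto intro!: holomorphic_intros \<tau> \<tau>')
    show "N 0 = 0" "siegel_prod \<tau> 0 = 0" by (simp_all add: N_def)
    show "(siegel_prod \<tau> has_field_derivative 2 * of_real pi * \<i>) (at 0)"
      by (rule siegel_prod_deriv_0[OF \<tau>])
    define G where "G = (\<lambda>z. J * e2pi (- (of_int c * z ^ 2 / (2 * J))))"
    have "((\<lambda>z. siegel_prod \<tau>' (z / J)) has_field_derivative (2 * of_real pi * \<i>) * (1 / J)) (at 0)"
      by (rule DERIV_chain2[of "siegel_prod \<tau>'"])
        (use siegel_prod_deriv_0[OF \<tau>'] J in \<open>auto intro!: derivative_eq_intros\<close>)
    moreover have "G field_differentiable at 0"
      unfolding G_def using J
      by (intro holomorphic_on_imp_differentiable_at[of _ UNIV] holomorphic_intros) auto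
    then obtain D where "(G has_field_derivative D) (at 0)"
      by (auto simp: field_differentiable_def)
    ultimately have "((\<lambda>z. G z * siegel_prod \<tau>' (z / J)) has_field_derivative
        G 0 * ((2 * of_real pi * \<i>) * (1 / J))) (at 0)"
      by (auto intro!: derivative_eq_intros)
    then show "(N has_field_derivative 2 * of_real pi * \<i>) (at 0)"
      using J by (simp add: N_def G_def)
    show "siegel_prod \<tau> (z + of_int m + of_int n * \<tau>) =
      e2pi ((of_int m + of_int n) / 2 - of_int n ^ 2 * \<tau> / 2 - of_int n * z) * siegel_prod \<tau> z" for z m n
      by (rule siegel_prod_lattice[OF \<tau>])
    show "N (z + of_int m + of_int n * \<tau>) =
      e2pi ((of_int m + of_int n) / 2 - of_int n ^ 2 * \<tau> / 2 - of_int n * z) * N z" for z m n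
    proof -
      \<comment> \<open>\<open>M\<close> and \<open>L\<close> are the coordinates of
        \<open>w / J\<close> in the basis 1, \<open>\<tau>'\<close>, found by inverting the
        matrix.\<close>
      define M L where "M = m * a - n * b" and "L = n * d - m * c"
      define w where "w = of_int m + of_int n * \<tau>"
      have tJ: "\<tau>' * J = of_int a * \<tau> + of_int b" using J by (simp add: \<tau>'_def)
      have "(of_int M + of_int L * \<tau>') * J = w"
      proof -
        have "(of_int M + of_int L * \<tau>') * J = of_int M * J + of_int L * (of_int a * \<tau> + of_int b)"
          unfolding tJ[symmetric] by (simp add: algebra_simps)
        also have "\<dots> = w * (of_int a * of_int d - of_int b * of_int c)"
          by (simp add: M_def L_def J_def w_def algebra_simps)
        finally show ?thesis by (simp add: detc)
      qed
      then have wJ: "w / J = of_int M + of_int L * \<tau>'" using J by (simp add: field_simps)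
      have cw: "of_int c * w = of_int n * J - of_int L"
        by (simp add: w_def J_def L_def algebra_simps)
      \<comment> \<open>A product (x + 1)(y + 1) is odd exactly when x and y are both even, and a
        change of basis of determinant 1 preserves that condition. Hence the signs left over when
        the two multipliers are compared cancel.\<close>
      have "even (M - m - n + L + M * L - m * n)"
      proof -
        have "d * M + b * L = m * (a * d - b * c)" "c * M + a * L = n * (a * d - b * c)"
          by (simp_all add: M_def L_def algebra_simps)
        then have "m = d * M + b * L" "n = c * M + a * L"
          using det by simp_all
        then have "even M \<and> even L \<longleftrightarrow> even m \<and> even n"
          by (metis M_def L_def dvd_add dvd_diff dvd_mult dvd_mult2)
        moreover have "M - m - n + L + M * L - m * n = (M + 1) * (L + 1) - (m + 1) * (n + 1)"
          by (simp add: algebra_simps)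
        ultimately show ?thesis by auto
      qed
      then obtain k where "M - m - n + L + M * L - m * n = 2 * k" by blast
      then have k: "of_int M - of_int m - of_int n + of_int L + of_int M * of_int L - of_int m * of_int n =
          (2 * of_int k :: complex)"
        by (metis of_int_add of_int_diff of_int_mult of_int_numeral)
      have e: "e2pi (- (of_int c * (z + w) ^ 2 / (2 * J)) + ((of_int M + of_int L) / 2 -
           of_int L ^ 2 * \<tau>' / 2 - of_int L * (z / J))) =
        e2pi (((of_int m + of_int n) / 2 - of_int n ^ 2 * \<tau> / 2 - of_int n * z) +
           - (of_int c * z ^ 2 / (2 * J)))"
      proof (rule e2pi_eqI)
        have "of_int c * (z + w) ^ 2 / (2 * J) =
            of_int c * z ^ 2 / (2 * J) + (of_int c * w) * z / J + (of_int c * w) * (w / J) / 2"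
          using J by (simp add: field_simps power2_eq_square)
        also have "\<dots> = of_int c * z ^ 2 / (2 * J) + of_int n * z - of_int L * z / J
            + of_int n * w / 2 - of_int L * (w / J) / 2"
          unfolding cw using J by (simp add: field_simps)
        finally have h: "of_int c * (z + w) ^ 2 / (2 * J) = of_int c * z ^ 2 / (2 * J) + of_int n * z -
            of_int L * z / J + of_int n * w / 2 - of_int L * (w / J) / 2" .
        have "- (of_int c * (z + w) ^ 2 / (2 * J)) + ((of_int M + of_int L) / 2 -
           of_int L ^ 2 * \<tau>' / 2 - of_int L * (z / J)) -
         (((of_int m + of_int n) / 2 - of_int n ^ 2 * \<tau> / 2 - of_int n * z) +
           - (of_int c * z ^ 2 / (2 * J))) = 
           (of_int M - of_int m - of_int n + of_int L + of_int M * of_int L - of_int m * of_int n) / 2"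
          unfolding h wJ unfolding w_def
          by (simp add: algebra_simps add_divide_distrib diff_divide_distrib power2_eq_square)
        then show "- (of_int c * (z + w) ^ 2 / (2 * J)) + ((of_int M + of_int L) / 2 -
           of_int L ^ 2 * \<tau>' / 2 - of_int L * (z / J)) -
         (((of_int m + of_int n) / 2 - of_int n ^ 2 * \<tau> / 2 - of_int n * z) +
           - (of_int c * z ^ 2 / (2 * J))) \<in> \<int>"
          unfolding k by simp
      qed
      have "N (z + of_int m + of_int n * \<tau>) = J * e2pi (- (of_int c * (z + w) ^ 2 / (2 * J))) *
          siegel_prod \<tau>' (z / J + of_int M + of_int L * \<tau>')"
        unfolding N_def w_def[symmetric] using wJ by (simp add: w_def add_divide_distrib add_ac)
      also have "\<dots> = J * e2pi (- (of_int c * (z + w) ^ 2 / (2 * J)) + ((of_int M + of_int L) / 2 -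
           of_int L ^ 2 * \<tau>' / 2 - of_int L * (z / J))) * siegel_prod \<tau>' (z / J)"
        unfolding siegel_prod_lattice[OF \<tau>'] by (simp only: e2pi_add mult_ac)
      also have "\<dots> = e2pi ((of_int m + of_int n) / 2 - of_int n ^ 2 * \<tau> / 2 - of_int n * z) * N z"
        unfolding e N_def by (simp only: e2pi_add mult_ac)
      finally show ?thesis .
    qed
  qed (use siegel_prod_eq_0D[OF \<tau>] in auto)
  then show ?thesis
    using J by (simp add: N_def e2pi_minus field_simps)
qed

section \<open>Klein forms and the discriminant\<close>

text \<open>Up to a constant factor this is the classical Klein form with characteristic (a1, a2).
  The exponential absorbs the quadratic one of \<open>siegel_prod_moebius\<close>, so that an exact
  weight -1 remains.\<close>

definition klein_form :: "complex \<Rightarrow> complex \<Rightarrow> complex \<Rightarrow> complex"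
  where "klein_form a1 a2 \<tau> = e2pi (a1 * (a1 * \<tau> + a2) / 2) * siegel_prod \<tau> (a1 * \<tau> + a2)"

text \<open>The row vector (a1, a2) gets multiplied by the matrix. The exponentials combine because
  \<open>a1 + of_int c * z = b1 * J\<close>, which rests on the determinant being 1.\<close>

lemma klein_form_moebius:
  fixes a b c d :: int
  assumes det: "a * d - b * c = 1" and \<tau>: "Im \<tau> > 0"
  defines "J \<equiv> of_int c * \<tau> + of_int d"
  shows "klein_form a1 a2 ((of_int a * \<tau> + of_int b) / J) =
    klein_form (a1 * of_int a + a2 * of_int c) (a1 * of_int b + a2 * of_int d) \<tau> / J"
proof -
  define \<tau>' where "\<tau>' = (of_int a * \<tau> + of_int b) / J"
  have J: "J \<noteq> 0" unfolding J_def using moebius_denom_nonzero[OF det \<tau>] .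
  have detc: "of_int a * of_int d - of_int b * of_int c = (1::complex)"
    using det by (metis of_int_1 of_int_diff of_int_mult)
  define b1 b2 where "b1 = a1 * of_int a + a2 * of_int c" and "b2 = a1 * of_int b + a2 * of_int d"
  define z where "z = b1 * \<tau> + b2"
  have z: "a1 * \<tau>' + a2 = z / J"
    using J by (simp add: \<tau>'_def z_def b1_def b2_def J_def field_simps)
  have a1: "a1 + of_int c * z = b1 * J"
  proof -
    have "a1 * (of_int a * of_int d - of_int b * of_int c) + of_int c * z = b1 * J"
      unfolding z_def b1_def b2_def J_def by (simp add: algebra_simps)
    then show ?thesis using detc by simp
  qed
  have "a1 * (z / J) / 2 + of_int c * z ^ 2 / (2 * J) = (a1 + of_int c * z) * z / (2 * J)"
    using J by (simp add: field_simps power2_eq_square)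
  also have "\<dots> = b1 * z / 2"
    unfolding a1 using J by simp
  finally have e: "e2pi (b1 * z / 2) = e2pi (a1 * (z / J) / 2) * e2pi (of_int c * z ^ 2 / (2 * J))"
    by (metis e2pi_add)
  show ?thesis
    unfolding klein_form_def \<tau>'_def[symmetric] b1_def[symmetric] b2_def[symmetric] z z_def[symmetric] e
    using siegel_prod_moebius[OF det \<tau>, of z] by (simp add: J_def \<tau>'_def)
qed

text \<open>The terms in \<open>\<tau>\<close> of the lattice multiplier and of the exponential
  prefactor cancel. What remains is constant in \<open>\<tau>\<close>, and a root of unity for
  rational \<open>a1\<close> and \<open>a2\<close>.\<close>

lemma klein_form_translate:
  assumes "Im \<tau> > 0"
  shows "klein_form (a1 + of_int n) (a2 + of_int m) \<tau> =
    e2pi ((a1 * of_int m - a2 * of_int n + of_int (n * m + n + m)) / 2) * klein_form a1 a2 \<tau>"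
proof -
  have z: "(a1 + of_int n) * \<tau> + (a2 + of_int m) = a1 * \<tau> + a2 + of_int m + of_int n * \<tau>"
    by (simp add: algebra_simps)
  have "(a1 + of_int n) * ((a1 + of_int n) * \<tau> + (a2 + of_int m)) / 2 +
      ((of_int m + of_int n) / 2 - of_int n ^ 2 * \<tau> / 2 - of_int n * (a1 * \<tau> + a2)) =
      (a1 * of_int m - a2 * of_int n + of_int (n * m + n + m)) / 2 + a1 * (a1 * \<tau> + a2) / 2"
    by (simp add: field_simps power2_eq_square)
  then have e: "e2pi ((a1 + of_int n) * ((a1 + of_int n) * \<tau> + (a2 + of_int m)) / 2) *
      e2pi ((of_int m + of_int n) / 2 - of_int n ^ 2 * \<tau> / 2 - of_int n * (a1 * \<tau> + a2)) =
      e2pi ((a1 * of_int m - a2 * of_int n + of_int (n * m + n + m)) / 2) * e2pi (a1 * (a1 * \<tau> + a2) / 2)"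
    by (metis e2pi_add)
  have "siegel_prod \<tau> ((a1 + of_int n) * \<tau> + (a2 + of_int m)) =
      e2pi ((of_int m + of_int n) / 2 - of_int n ^ 2 * \<tau> / 2 - of_int n * (a1 * \<tau> + a2)) *
      siegel_prod \<tau> (a1 * \<tau> + a2)"
    unfolding z by (rule siegel_prod_lattice[OF assms])
  then show ?thesis
    unfolding klein_form_def mult.assoc[symmetric] e[symmetric] by (simp only: mult.assoc)
qed

text \<open>At the 2-division points the multiplier of a translation is a fourth root of unity.\<close>

definition klein_half4 :: "int \<Rightarrow> int \<Rightarrow> complex \<Rightarrow> complex"
  where "klein_half4 r s \<tau> = klein_form (of_int r / 2) (of_int s / 2) \<tau> ^ 4"

lemma klein_half4_translate:
  assumes "Im \<tau> > 0"
  shows "klein_half4 (r + 2 * n) (s + 2 * m) \<tau> = klein_half4 r s \<tau>"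
proof -
  define u :: complex where "u = (of_int r / 2 * of_int m - of_int s / 2 * of_int n + of_int (n * m + n + m)) / 2"
  have "of_nat 4 * u = of_int (r * m - s * n + 2 * (n * m + n + m))"
    by (simp add: u_def field_simps)
  then have "e2pi u ^ 4 = 1"
    by (metis e2pi_of_int e2pi_of_nat_mult)
  moreover have "klein_form (of_int (r + 2 * n) / 2) (of_int (s + 2 * m) / 2) \<tau> =
      e2pi u * klein_form (of_int r / 2) (of_int s / 2) \<tau>"
    using klein_form_translate[OF assms, of "of_int r / 2" n "of_int s / 2" m]
    by (simp add: u_def add_divide_distrib)
  ultimately show ?thesis by (simp add: klein_half4_def power_mult_distrib)
qed

lemma klein_half4_mod_2:
  assumes "Im \<tau> > 0"
  shows "klein_half4 r s \<tau> = klein_half4 (r mod 2) (s mod 2) \<tau>"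
  using klein_half4_translate[OF assms, of "r mod 2" "r div 2" "s mod 2" "s div 2"] by simp

lemma klein_half4_moebius:
  fixes a b c d :: int
  assumes det: "a * d - b * c = 1" and \<tau>: "Im \<tau> > 0"
  defines "J \<equiv> of_int c * \<tau> + of_int d"
  shows "klein_half4 r s ((of_int a * \<tau> + of_int b) / J) =
    klein_half4 (r * a + s * c) (r * b + s * d) \<tau> / J ^ 4"
  using klein_form_moebius[OF det \<tau>, of "of_int r / 2" "of_int s / 2"]
  by (simp add: klein_half4_def J_def power_divide add_divide_distrib)

text \<open>Modulo 2 the matrix permutes the three nonzero vectors (0, 1), (1, 0) and (1, 1), and
  \<open>klein_half4\<close> depends on its indices only modulo 2. Three factors of weight -4 make
  weight -12.\<close>

lemma klein_half4_prod_moebius: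
  fixes a b c d :: int
  assumes det: "a * d - b * c = 1" and \<tau>: "Im \<tau> > 0"
  defines "J \<equiv> of_int c * \<tau> + of_int d"
  defines "P \<equiv> \<lambda>\<tau>. klein_half4 0 1 \<tau> * klein_half4 1 0 \<tau> * klein_half4 1 1 \<tau>"
  shows "P ((of_int a * \<tau> + of_int b) / J) = P \<tau> / J ^ 12"
proof -
  have "P ((of_int a * \<tau> + of_int b) / J) =
      klein_half4 c d \<tau> * klein_half4 a b \<tau> * klein_half4 (a + c) (b + d) \<tau> / J ^ 12"
    unfolding P_def J_def klein_half4_moebius[OF det \<tau>]
    by (simp add: power_add[symmetric])
  also have "klein_half4 c d \<tau> * klein_half4 a b \<tau> * klein_half4 (a + c) (b + d) \<tau> = P \<tau>"
  proof -
    have "odd (a * d - b * c)" using det by simp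
    then have odd: "(odd a \<and> odd d) \<noteq> (odd b \<and> odd c)" by auto
    have "x mod 2 = (if even x then 0 else 1)" for x :: int by presburger
    note k = klein_half4_mod_2[OF \<tau>, unfolded this]
    show ?thesis
      unfolding P_def k[of c] k[of a] k[of "a + c"]
      using odd by (cases "even a"; cases "even b"; cases "even c"; cases "even d") (simp_all add: mult_ac)
  qed
  finally show ?thesis .
qed

lemma dedekind_eta_eq: "dedekind_eta \<tau> = e2pi (\<tau> / 24) * qpoch (e2pi \<tau>) (e2pi \<tau>)"
  by (simp add: dedekind_eta_def e2pi_def qpoch_def)

lemma dedekind_eta_nonzero:
  assumes "Im \<tau> > 0"
  shows "dedekind_eta \<tau> \<noteq> 0"
  using qpoch_self_nonzero[OF norm_e2pi_less_1[OF assms]] by (simp add: dedekind_eta_eq)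

lemma dedekind_eta_plus_1: "dedekind_eta (\<tau> + 1) = e2pi (1 / 24) * dedekind_eta \<tau>"
  by (simp add: dedekind_eta_eq e2pi_add add_divide_distrib)

lemma dedekind_eta_plus_nat: "dedekind_eta (\<tau> + of_nat n) = e2pi (of_nat n / 24) * dedekind_eta \<tau>"
  by (simp add: dedekind_eta_eq e2pi_add add_divide_distrib)

text \<open>Euler's identity, familiar from partitions into distinct and into odd parts. Both
  factors arise from comparing \<open>qpoch q q\<close> with
  \<open>qpoch (q\<^sup>2) (q\<^sup>2)\<close>.\<close>

lemma qpoch_euler:
  assumes q: "norm q < 1"
  shows "qpoch (- q) q * qpoch q (q\<^sup>2) = 1"
proof -
  have "qpoch q q * qpoch (- q) q = qpoch (q\<^sup>2) (q\<^sup>2)"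
    by (rule qpoch_minus[OF q])
  moreover have "qpoch q q = qpoch q (q\<^sup>2) * qpoch (q\<^sup>2) (q\<^sup>2)"
    using qpoch_base_square[OF q, of q] by (simp add: power2_eq_square)
  ultimately have "qpoch q q * (qpoch (- q) q * qpoch q (q\<^sup>2)) = qpoch q q * 1"
    by (simp add: mult_ac)
  then show ?thesis
    using qpoch_self_nonzero[OF q] by (simp only: mult_cancel_left) simp
qed

text \<open>The condition on \<open>a\<close> treats \<open>a = 0\<close> and
  \<open>a = 1 / 2\<close> together: in either case \<open>t\<close> is a square root of
  \<open>q\<close>, so \<open>inverse t * q = t\<close> and both infinite products reduce to
  \<open>qpoch t q\<close>.\<close>

lemma klein_form_half_power4:
  assumes \<tau>: "Im \<tau> > 0" and a: "e2pi a ^ 2 = 1"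
  defines "t \<equiv> e2pi (\<tau> / 2 + a)" and "q \<equiv> e2pi \<tau>"
  shows "klein_form (1 / 2) a \<tau> ^ 4 = qpoch t q ^ 8 / (t * qpoch q q ^ 8)"
proof -
  \<comment> \<open>\<open>V\<close> is the exponential prefactor of the Klein form and a fourth
    root of \<open>t\<close>.\<close>
  define V where "V = e2pi ((\<tau> / 2 + a) / 4)"
  have V: "V \<noteq> 0" "V ^ 4 = t" and V2: "e2pi ((\<tau> / 2 + a) / 2) = V ^ 2"
    unfolding V_def t_def e2pi_of_nat_mult[symmetric]
    by (simp, (rule arg_cong[of _ _ e2pi], simp add: field_simps)+)
  have tq: "q = t ^ 2"
    using e2pi_of_nat_mult[of 2 "\<tau> / 2"] a by (simp add: t_def q_def e2pi_add power_mult_distrib)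
  have q: "norm q < 1" unfolding q_def by (rule norm_e2pi_less_1[OF \<tau>])
  have nz: "t \<noteq> 0" "qpoch q q \<noteq> 0"
    using qpoch_self_nonzero[OF q] by (auto simp: t_def)
  have it: "inverse t * q = t" using nz by (simp add: tq power2_eq_square)
  have "klein_form (1 / 2) a \<tau> = V * ((V ^ 2 - inverse (V ^ 2)) * qpoch (t * q) q * qpoch t q / qpoch q q ^ 2)"
    unfolding klein_form_def siegel_prod_def two_i_sin_pi V_def q_def[symmetric]
    using V2 it by (simp add: V_def t_def)
  also have "\<dots> = - ((1 - t) * qpoch (t * q) q * qpoch t q / (V * qpoch q q ^ 2))"
    unfolding V(2)[symmetric] using V(1) nz(2) by (simp add: field_simps power2_eq_square power4_eq_xxxx)
  also have "(1 - t) * qpoch (t * q) q = qpoch t q"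
    using qpoch_rec[OF q, of t] by simp
  finally have "klein_form (1 / 2) a \<tau> ^ 4 = (qpoch t q * qpoch t q) ^ 4 / (V ^ 4 * (qpoch q q ^ 2) ^ 4)"
    by (simp add: power_divide power_mult_distrib)
  then show ?thesis
    by (simp add: V power_mult[symmetric] power_add[symmetric] power2_eq_square[symmetric])
qed

text \<open>The 16 is (2i)^4. The infinite products other than \<open>qpoch q q\<close> combine to 1
  by \<open>qpoch_minus\<close> and \<open>qpoch_euler\<close>, and the two factors \<open>s\<close>
  supply the leading \<open>q\<close> of \<open>dedekind_eta \<tau> ^ 24\<close>.\<close>

lemma klein_half4_prod_eq:
  assumes \<tau>: "Im \<tau> > 0"
  shows "klein_half4 0 1 \<tau> * klein_half4 1 0 \<tau> * klein_half4 1 1 \<tau> = - 16 / dedekind_eta \<tau> ^ 24"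
proof -
  define q s where "q = e2pi \<tau>" and "s = e2pi (\<tau> / 2)"
  have q: "norm q < 1" unfolding q_def by (rule norm_e2pi_less_1[OF \<tau>])
  have s: "s ^ 2 = q"
    using e2pi_of_nat_mult[of 2 "\<tau> / 2"] by (simp add: s_def q_def)
  have nz: "s \<noteq> 0" "q \<noteq> 0" "qpoch q q \<noteq> 0"
    using qpoch_self_nonzero[OF q] by (auto simp: s_def q_def)
  have 1: "klein_half4 0 1 \<tau> = 16 * qpoch (- q) q ^ 8 / qpoch q q ^ 8"
    by (simp add: klein_half4_def klein_form_def siegel_prod_def q_def[symmetric] sin_of_real
        power_divide power_mult_distrib power_mult[symmetric] power_add[symmetric])
  have 2: "klein_half4 1 0 \<tau> = qpoch s q ^ 8 / (s * qpoch q q ^ 8)"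
    using klein_form_half_power4[OF \<tau>, of 0] by (simp add: klein_half4_def s_def q_def)
  have 3: "klein_half4 1 1 \<tau> = - (qpoch (- s) q ^ 8 / (s * qpoch q q ^ 8))"
    using klein_form_half_power4[OF \<tau>, of "1 / 2"] by (simp add: klein_half4_def s_def q_def e2pi_add)
  have "klein_half4 0 1 \<tau> * klein_half4 1 0 \<tau> * klein_half4 1 1 \<tau> =
      - 16 * (qpoch (- q) q * (qpoch s q * qpoch (- s) q)) ^ 8 / (s ^ 2 * (qpoch q q ^ 8 * qpoch q q ^ 8 * qpoch q q ^ 8))"
    unfolding 1 2 3 by (simp add: power_mult_distrib power2_eq_square mult_ac)
  also have "qpoch s q * qpoch (- s) q = qpoch q (q\<^sup>2)"
    using qpoch_minus[OF q, of s] by (simp add: s)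
  also have "qpoch (- q) q * qpoch q (q\<^sup>2) = 1"
    by (rule qpoch_euler[OF q])
  also have "qpoch q q ^ 8 * qpoch q q ^ 8 * qpoch q q ^ 8 = qpoch q q ^ 24"
    by (simp add: power_add[symmetric])
  also have "s ^ 2 * qpoch q q ^ 24 = dedekind_eta \<tau> ^ 24"
    using e2pi_of_nat_mult[of 24 "\<tau> / 24"] by (simp add: dedekind_eta_eq power_mult_distrib s q_def)
  finally show ?thesis by simp
qed

theorem dedekind_eta_power24_moebius:
  fixes a b c d :: int
  assumes det: "a * d - b * c = 1" and \<tau>: "Im \<tau> > 0"
  defines "J \<equiv> of_int c * \<tau> + of_int d"
  shows "dedekind_eta ((of_int a * \<tau> + of_int b) / J) ^ 24 = J ^ 12 * dedekind_eta \<tau> ^ 24"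
proof -
  define \<tau>' where "\<tau>' = (of_int a * \<tau> + of_int b) / J"
  have J: "J \<noteq> 0" and \<tau>': "Im \<tau>' > 0"
    unfolding \<tau>'_def J_def using moebius_denom_nonzero[OF det \<tau>] Im_moebius_pos[OF det \<tau>] by auto
  have "- 16 / dedekind_eta \<tau>' ^ 24 = - 16 / dedekind_eta \<tau> ^ 24 / J ^ 12"
    using klein_half4_prod_moebius[OF det \<tau>]
    unfolding klein_half4_prod_eq[OF \<tau>] klein_half4_prod_eq[OF \<tau>', unfolded \<tau>'_def J_def] J_def \<tau>'_def .
  then show ?thesis
    unfolding \<tau>'_def[symmetric]
    using J dedekind_eta_nonzero[OF \<tau>] dedekind_eta_nonzero[OF \<tau>'] by (simp add: field_simps)
qed

section \<open>The eta ratio on \<open>\<Gamma>\<^sub>1(p)\<close>\<close>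

text \<open>Each factor \<open>1 - (q ^ Suc n) ^ p\<close> splits over the p-th roots of unity, and
  the finite product is interchanged with the infinite one.\<close>

lemma qpoch_power_power:
  assumes p: "p > 0" and q: "norm q < 1"
  shows "qpoch (q ^ p) (q ^ p) = (\<Prod>j<p. qpoch (e2pi (of_nat j / of_nat p) * q) q)"
proof -
  have w: "e2pi (of_nat j / of_nat p) = cis (2 * pi * real j / real p)" for j
    by (simp add: e2pi_def cis_conv_exp mult_ac)
  have "(\<Prod>j<p. qpoch (e2pi (of_nat j / of_nat p) * q) q) =
      (\<Prod>n. \<Prod>j<p. 1 - e2pi (of_nat j / of_nat p) * q * q ^ n)"
    unfolding qpoch_def by (intro prodinf_prod[symmetric] convergent_prod_qpoch q)
  also have "\<dots> = (\<Prod>n. 1 - q ^ p * (q ^ p) ^ n)"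
  proof (rule prodinf_cong)
    fix n
    have "(\<Prod>j<p. 1 - e2pi (of_nat j / of_nat p) * q * q ^ n) = 1 - (q ^ Suc n) ^ p"
      using prod_one_minus_roots_unity[OF p, of "q ^ Suc n"] by (simp add: w mult.assoc)
    also have "(q ^ Suc n) ^ p = q ^ p * (q ^ p) ^ n"
      by (simp add: power_mult_distrib power_mult[symmetric] mult_ac)
    finally show "(\<Prod>j<p. 1 - e2pi (of_nat j / of_nat p) * q * q ^ n) = 1 - q ^ p * (q ^ p) ^ n" .
  qed
  finally show ?thesis by (simp add: qpoch_def)
qed

text \<open>For functions of roots of unity the pairing of indices puts each root next to its
  inverse.\<close>

lemma prod_lessThan_odd:
  fixes f :: "nat \<Rightarrow> 'a :: comm_monoid_mult"
  shows "(\<Prod>j<2 * m + 1. f j) = f 0 * (\<Prod>j=1..m. f j * f (2 * m + 1 - j))"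
proof -
  have "(\<Prod>j=1..m. f (2 * m + 1 - j)) = (\<Prod>j=m+1..2*m. f j)"
    by (rule prod.reindex_bij_witness[of _ "\<lambda>j. 2 * m + 1 - j" "\<lambda>j. 2 * m + 1 - j"]) auto
  moreover have "{..<2 * m + 1} = insert 0 ({1..m} \<union> {m+1..2*m})" by auto
  then have "(\<Prod>j<2 * m + 1. f j) = f 0 * ((\<Prod>j=1..m. f j) * (\<Prod>j=m+1..2*m. f j))"
    by (simp add: prod.union_disjoint)
  ultimately show ?thesis by (simp add: prod.distrib)
qed

text \<open>The root of unity 1 contributes \<open>qpoch q q\<close>, and each pair of inverse roots
  gives a value of \<open>siegel_prod\<close> without its sine factor. The powers of
  \<open>e2pi (\<tau> / 24)\<close> cancel, and the remaining \<open>p - 1\<close> factors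
  \<open>qpoch q q\<close> of the denominator are shared out as \<open>m\<close> squares.\<close>

lemma dedekind_eta_ratio:
  assumes \<tau>: "Im \<tau> > 0" and p: "p = 2 * m + 1"
  shows "dedekind_eta (of_nat p * \<tau>) / dedekind_eta \<tau> ^ p =
    (\<Prod>j=1..m. siegel_prod \<tau> (of_nat j / of_nat p) / (2 * \<i> * sin (of_real pi * (of_nat j / of_nat p))))"
proof -
  define q where "q = e2pi \<tau>"
  define E where "E = (\<lambda>x. qpoch (x * q) q)"
  define w where "w = (\<lambda>j. e2pi (of_nat j / of_nat p))"
  have q: "norm q < 1" unfolding q_def by (rule norm_e2pi_less_1[OF \<tau>])
  have nz: "qpoch q q \<noteq> 0" by (rule qpoch_self_nonzero[OF q])
  have "dedekind_eta (of_nat p * \<tau>) = e2pi (\<tau> / 24) ^ p * qpoch (q ^ p) (q ^ p)"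
    using e2pi_of_nat_mult[of p "\<tau> / 24"] by (simp add: dedekind_eta_eq e2pi_of_nat_mult q_def)
  then have "dedekind_eta (of_nat p * \<tau>) / dedekind_eta \<tau> ^ p = (\<Prod>j<p. E (w j)) / qpoch q q ^ p"
    using p qpoch_power_power[OF _ q, of p]
    by (simp add: dedekind_eta_eq power_mult_distrib q_def E_def w_def)
  also have "(\<Prod>j<p. E (w j)) = qpoch q q * (\<Prod>j=1..m. E (w j) * E (w (p - j)))"
    using prod_lessThan_odd[of "\<lambda>j. E (w j)" m] p by (simp add: E_def w_def)
  also have "(\<Prod>j=1..m. E (w j) * E (w (p - j))) = (\<Prod>j=1..m. E (w j) * E (inverse (w j)))"
  proof (rule prod.cong)
    fix j assume j: "j \<in> {1..m}"
    have "of_nat (p - j) / of_nat p = 1 - of_nat j / (of_nat p :: complex)"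
      using j p by (simp add: of_nat_diff diff_divide_distrib del: of_nat_Suc of_nat_add of_nat_mult)
    then have "w (p - j) = inverse (w j)"
      unfolding w_def by (simp only: e2pi_diff) (simp add: field_simps)
    then show "E (w j) * E (w (p - j)) = E (w j) * E (inverse (w j))" by simp
  qed simp
  also have "qpoch q q * (\<Prod>j=1..m. E (w j) * E (inverse (w j))) / qpoch q q ^ p =
      (\<Prod>j=1..m. E (w j) * E (inverse (w j)) / qpoch q q ^ 2)"
    using nz by (simp add: p prod_dividef power_mult)
  also have "\<dots> = (\<Prod>j=1..m. siegel_prod \<tau> (of_nat j / of_nat p) /
      (2 * \<i> * sin (of_real pi * (of_nat j / of_nat p))))"
  proof (rule prod.cong)
    fix j assume j: "j \<in> {1..m}"
    have "sin (of_real (pi * (real j / real p))) \<noteq> (0::complex)"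
    proof -
      have "0 < pi * (real j / real p)" using j p by auto
      moreover have "pi * (real j / real p) < pi * 1"
        using j p by (intro mult_strict_left_mono) auto
      ultimately have "sin (pi * (real j / real p)) \<noteq> 0"
        using sin_gt_zero by force
      then show ?thesis by (simp only: sin_of_real of_real_eq_0_iff) simp
    qed
    then show "E (w j) * E (inverse (w j)) / qpoch q q ^ 2 = siegel_prod \<tau> (of_nat j / of_nat p) /
        (2 * \<i> * sin (of_real pi * (of_nat j / of_nat p)))"
      by (simp add: siegel_prod_def E_def w_def q_def)
  qed simp
  finally show ?thesis .
qed

lemma sum_squares_atLeastAtMost: "6 * (\<Sum>j=1..m. j ^ 2) = m * (m + 1) * (2 * m + 1)" for m :: nat
  by (induction m) (auto simp: algebra_simps power2_eq_square)

lemma sum_atLeastAtMost_1: "2 * (\<Sum>j=1..m. j) = m * (m + 1)" for m :: nat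
  by (induction m) (auto simp: algebra_simps)

text \<open>For \<open>p = 2 m + 1\<close> coprime to 6, \<open>N = (p\<^sup>2 - 1) / 24\<close>.\<close>

theorem dedekind_eta_ratio_Gamma1:
  fixes a b c d :: int and p m N :: nat
  assumes det: "a * d - b * c = 1" and \<tau>: "Im \<tau> > 0" and p: "p = 2 * m + 1" and N: "m * (m + 1) = 6 * N"
    and c: "c = int p * c'" and d: "d = 1 + int p * d'"
  defines "J \<equiv> of_int c * \<tau> + of_int d"
  defines "G \<equiv> \<lambda>\<tau>. dedekind_eta (of_nat p * \<tau>) / dedekind_eta \<tau> ^ p"
  shows "G ((of_int a * \<tau> + of_int b) / J) = G \<tau> / J ^ m"
proof -
  define \<tau>' where "\<tau>' = (of_int a * \<tau> + of_int b) / J"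
  have J: "J \<noteq> 0" and \<tau>': "Im \<tau>' > 0"
    unfolding \<tau>'_def J_def using moebius_denom_nonzero[OF det \<tau>] Im_moebius_pos[OF det \<tau>] by auto
  have p0: "of_nat p \<noteq> (0 :: complex)" using p by (simp only: of_nat_eq_0_iff)
  \<comment> \<open>The matrix sends the characteristic (0, j/p) to its translate by the integral
    vector j (c', d'); \<open>\<theta> j\<close> is the resulting exponent in
    \<open>klein_form_translate\<close>.\<close>
  define \<theta> :: "nat \<Rightarrow> complex" where "\<theta> = (\<lambda>j. (- of_int c' / of_nat p * of_nat (j ^ 2) +
      of_int (c' * d') * of_nat (j ^ 2) + of_int (c' + d') * of_nat j) / 2)"
  have siegel: "siegel_prod \<tau>' (of_nat j / of_nat p) = e2pi (\<theta> j) * siegel_prod \<tau> (of_nat j / of_nat p) / J" for j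
  proof -
    have "siegel_prod \<tau>' (of_nat j / of_nat p) = klein_form 0 (of_nat j / of_nat p) \<tau>'"
      by (simp add: klein_form_def)
    also have "\<dots> = klein_form (of_nat j / of_nat p * of_int c) (of_nat j / of_nat p * of_int d) \<tau> / J"
      using klein_form_moebius[OF det \<tau>, of 0 "of_nat j / of_nat p"] by (simp add: \<tau>'_def J_def)
    also have "of_nat j / of_nat p * of_int c = (0 + of_int (int j * c') :: complex)"
      using p0 by (simp add: c)
    also have "of_nat j / of_nat p * of_int d = (of_nat j / of_nat p + of_int (int j * d') :: complex)"
      using p0 by (simp add: d field_simps)
    also have "klein_form (0 + of_int (int j * c')) (of_nat j / of_nat p + of_int (int j * d')) \<tau> =
        e2pi (\<theta> j) * klein_form 0 (of_nat j / of_nat p) \<tau>"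
    proof -
      have "(0 * of_int (int j * d') - of_nat j / of_nat p * of_int (int j * c') +
        of_int (int j * c' * (int j * d') + int j * c' + int j * d')) / 2 = \<theta> j"
        by (simp add: \<theta>_def algebra_simps power2_eq_square)
      then show ?thesis
        unfolding klein_form_translate[OF \<tau>] by simp
    qed
    finally show ?thesis by (simp add: klein_form_def)
  qed
  have "e2pi (\<Sum>j=1..m. \<theta> j) = 1"
  proof -
    \<comment> \<open>The sum of the squares is divisible by \<open>p\<close>, which clears the
      denominator in the first term of \<open>\<theta>\<close>.\<close>
    have S2: "(\<Sum>j=1..m. j ^ 2) = p * N"
      using sum_squares_atLeastAtMost[of m] unfolding N p[symmetric] by simp
    have S1: "(\<Sum>j=1..m. j) = 3 * N"
      using sum_atLeastAtMost_1[of m] unfolding N by simp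
    have "(\<Sum>j=1..m. \<theta> j) = (- of_int c' / of_nat p * of_nat (\<Sum>j=1..m. j ^ 2) +
        of_int (c' * d') * of_nat (\<Sum>j=1..m. j ^ 2) + of_int (c' + d') * of_nat (\<Sum>j=1..m. j)) / 2"
      unfolding \<theta>_def of_nat_sum sum_distrib_left sum.distrib[symmetric] sum_divide_distrib[symmetric] ..
    also have "\<dots> = of_int (int N * (2 * c' + d' * (3 + c' * int p))) / 2"
      unfolding S1 S2 using p0 by (simp add: algebra_simps)
    \<comment> \<open>If \<open>d'\<close> is odd, then \<open>d\<close> is even because
      \<open>p\<close> is odd, so the determinant forces \<open>c\<close>, and with it
      \<open>c'\<close>, to be odd; then \<open>3 + c' * int p\<close> is even.\<close>
    also have "even (int N * (2 * c' + d' * (3 + c' * int p)))"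
    proof -
      have "odd (a * d - b * c)" using det by simp
      moreover have "odd (int p)" using p by simp
      ultimately show ?thesis unfolding c d by auto
    qed
    then obtain l where "int N * (2 * c' + d' * (3 + c' * int p)) = 2 * l" by blast
    finally have "(\<Sum>j=1..m. \<theta> j) = of_int l" by simp
    then show ?thesis by simp
  qed
  then have "(\<Prod>j=1..m. e2pi (\<theta> j)) = 1"
    by (simp add: e2pi_sum)
  then have prod: "(\<Prod>j=1..m. siegel_prod \<tau>' (of_nat j / of_nat p)) =
      (\<Prod>j=1..m. siegel_prod \<tau> (of_nat j / of_nat p)) / J ^ m"
    by (simp add: siegel prod_dividef prod.distrib)
  show ?thesis
    unfolding G_def \<tau>'_def[symmetric] dedekind_eta_ratio[OF \<tau> p] dedekind_eta_ratio[OF \<tau>' p] prod_dividef prod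
    by simp
qed

section \<open>Behaviour at the cusps\<close>

text \<open>The absolute value of the discriminant \<Delta>. Growth at the cusps is a matter of
  moduli, and passing to them suppresses the roots of unity in the transformation of
  \<open>dedekind_eta\<close>.\<close>

definition norm_delta :: "complex \<Rightarrow> real"
  where "norm_delta z = norm (dedekind_eta z) ^ 24"

lemma norm_delta_moebius:
  fixes a b c d :: int
  assumes "a * d - b * c = 1" and "Im z > 0"
  shows "norm_delta ((of_int a * z + of_int b) / (of_int c * z + of_int d)) =
    norm (of_int c * z + of_int d) ^ 12 * norm_delta z"
  unfolding norm_delta_def norm_power[symmetric] norm_mult[symmetric]
  using dedekind_eta_power24_moebius[OF assms] by simp

text \<open>The factorisation \<open>(p,0;0,1) (a,b;c,d) = A' (p,0;0,1)\<close> with \<open>A' \<in> SL\<^sub>2(\<int>)\<close>.\<close>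

lemma norm_delta_p_moebius_dvd:
  fixes a b c d :: int
  assumes det: "a * d - b * c = 1" and z: "Im z > 0" and p: "p > 0" "int p dvd c"
  shows "norm_delta (of_nat p * ((of_int a * z + of_int b) / (of_int c * z + of_int d))) =
    norm (of_int c * z + of_int d) ^ 12 * norm_delta (of_nat p * z)"
proof -
  obtain e where e: "c = int p * e" using p(2) by blast
  have "a * d - (int p * b) * e = 1" using det by (simp add: e mult_ac)
  moreover have "Im (of_nat p * z) > 0" using p z by simp
  ultimately have "norm_delta ((of_int a * (of_nat p * z) + of_int (int p * b)) / (of_int e * (of_nat p * z) + of_int d)) =
      norm (of_int e * (of_nat p * z) + of_int d) ^ 12 * norm_delta (of_nat p * z)"
    by (rule norm_delta_moebius)
  then show ?thesis by (simp add: e algebra_simps)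
qed

text \<open>The factorisation \<open>(p,0;0,1) (a,b;c,d) = A' (1,\<beta>;0,p)\<close> with \<open>A' \<in> SL\<^sub>2(\<int>)\<close>.\<close>

lemma norm_delta_p_moebius_not_dvd:
  fixes a b c d :: int
  assumes det: "a * d - b * c = 1" and p: "prime p" "\<not> int p dvd c"
  obtains \<beta> :: int where "\<And>z. Im z > 0 \<Longrightarrow>
    norm_delta (of_nat p * ((of_int a * z + of_int b) / (of_int c * z + of_int d))) =
    (norm (of_int c * z + of_int d) / real p) ^ 12 * norm_delta ((z + of_int \<beta>) / of_nat p)"
proof -
  have p0: "p > 0" using p(1) prime_gt_0_nat by blast
  have "coprime (int p) c" using p by (intro prime_imp_coprime) auto
  \<comment> \<open>\<open>x\<close> is the \<open>\<beta>\<close> of the factorisation: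
    \<open>A'\<close> has the entries \<open>int p * a\<close>, \<open>b - a * x\<close>,
    \<open>c\<close> and \<open>e\<close>, and the congruence makes \<open>e\<close>
    integral.\<close>
  then obtain x where "[c * x = d] (mod int p)"
    using cong_solve_coprime_int[of c "int p"] by (metis cong_scalar_right coprime_commute mult.assoc mult.right_neutral mult.commute)
  then have "int p dvd d - c * x" by (metis cong_iff_dvd_diff cong_sym)
  then obtain e where e: "d - c * x = int p * e" by blast
  show thesis
  proof (rule that[of x])
    fix z :: complex assume z: "Im z > 0"
    define w where "w = (z + of_int x) / of_nat p"
    have zw: "z = of_nat p * w - of_int x" using p0 by (simp add: w_def)
    have d: "d = int p * e + c * x" using e by simp
    have "(int p * a) * e - (b - a * x) * c = 1"
      using det unfolding d by (simp add: algebra_simps)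
    moreover have "Im w > 0" using z p0 by (simp add: w_def)
    ultimately have "norm_delta ((of_int (int p * a) * w + of_int (b - a * x)) / (of_int c * w + of_int e)) =
      norm (of_int c * w + of_int e) ^ 12 * norm_delta w"
      by (rule norm_delta_moebius)
    moreover have "of_int c * z + of_int d = of_nat p * (of_int c * w + of_int e)"
      by (simp add: zw d algebra_simps)
    moreover have "of_int a * z + of_int b = of_int (int p * a) * w + of_int (b - a * x)"
      by (simp add: zw algebra_simps)
    moreover have "of_nat p * ((of_int (int p * a) * w + of_int (b - a * x)) / (of_nat p * (of_int c * w + of_int e))) =
        (of_int (int p * a) * w + of_int (b - a * x)) / (of_int c * w + of_int e)"
      using p0 by simp
    ultimately show "norm_delta (of_nat p * ((of_int a * z + of_int b) / (of_int c * z + of_int d))) =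
      (norm (of_int c * z + of_int d) / real p) ^ 12 * norm_delta ((z + of_int x) / of_nat p)"
      using p0 by (simp only: w_def[symmetric] norm_mult) simp
  qed
qed

lemma eta_quotient_apply:
  "Im z > 0 \<Longrightarrow> eta_quotient p r1 rp z = dedekind_eta z powi r1 * dedekind_eta (of_nat p * z) powi rp"
  by (simp add: eta_quotient_def upper_half_plane_def)

lemma norm_eta_quotient:
  "Im z > 0 \<Longrightarrow> norm (eta_quotient p r1 rp z) ^ 24 = norm_delta z powi r1 * norm_delta (of_nat p * z) powi rp"
  by (simp add: eta_quotient_apply norm_mult norm_power_int norm_delta_def power_mult_distrib
      power_int_power power_int_power' mult.commute)

lemma eta_quotient_nonzero:
  assumes "Im z > 0" "p > 0"
  shows "eta_quotient p r1 rp z \<noteq> 0"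
  using assms dedekind_eta_nonzero[of z] dedekind_eta_nonzero[of "of_nat p * z"]
  by (simp add: eta_quotient_apply)

lemma SL2Z_iff: "A \<in> SL2Z \<longleftrightarrow> A $ 1 $ 1 * A $ 2 $ 2 - A $ 1 $ 2 * A $ 2 $ 1 = 1"
  by (simp add: SL2Z_def det_2)

lemma moebius_act_in_upper_half_plane:
  "A \<in> SL2Z \<Longrightarrow> Im z > 0 \<Longrightarrow> Im (moebius_act A z) > 0"
  unfolding SL2Z_iff moebius_act_def by (rule Im_moebius_pos)

text \<open>\<open>\<alpha>\<close> tells the two kinds of cusps apart: \<infinity> if
  \<open>p\<close> divides the lower left entry, 0 otherwise. The 24th power allows every factor to
  be expressed by \<open>norm_delta\<close>, and the exponent of the automorphy factor becomes 0
  once \<open>k\<close> is the weight.\<close>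

lemma norm_slash_eta_quotient:
  assumes A: "A \<in> SL2Z" and p: "prime p"
  obtains C \<alpha> :: real and \<beta> :: real where "C > 0" "\<alpha> = (if int p dvd A $ 2 $ 1 then real p else 1 / real p)"
    "\<And>z. Im z > 0 \<Longrightarrow> norm (slash k (eta_quotient p r1 rp) A z) ^ 24 =
      C * norm (of_int (A $ 2 $ 1) * z + of_int (A $ 2 $ 2)) powi (12 * (r1 + rp) - 24 * k) *
      norm_delta z powi r1 * norm_delta (of_real \<alpha> * z + of_real \<beta>) powi rp"
proof -
  have det: "A $ 1 $ 1 * A $ 2 $ 2 - A $ 1 $ 2 * A $ 2 $ 1 = 1"
    using A by (simp add: SL2Z_iff)
  have p0: "p > 0" using p prime_gt_0_nat by blast
  define J :: "complex \<Rightarrow> complex" where "J = (\<lambda>z. of_int (A $ 2 $ 1) * z + of_int (A $ 2 $ 2))"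
  have "\<exists>C \<alpha> \<beta>. C > 0 \<and> \<alpha> = (if int p dvd A $ 2 $ 1 then real p else 1 / real p) \<and>
    (\<forall>z. Im z > 0 \<longrightarrow> norm_delta (of_nat p * moebius_act A z) = C * norm (J z) ^ 12 *
      norm_delta (of_real \<alpha> * z + of_real \<beta>))"
  proof (cases "int p dvd A $ 2 $ 1")
    case True
    then show ?thesis
      using norm_delta_p_moebius_dvd[OF det _ p0 True]
      by (intro exI[of _ 1] exI[of _ "real p"] exI[of _ 0]) (auto simp: moebius_act_def J_def)
  next
    case False
    from norm_delta_p_moebius_not_dvd[OF det p this] obtain \<beta> :: int where \<beta>: "\<And>z. Im z > 0 \<Longrightarrow>
      norm_delta (of_nat p * moebius_act A z) = (norm (J z) / real p) ^ 12 * norm_delta ((z + of_int \<beta>) / of_nat p)"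
      unfolding moebius_act_def J_def by blast
    have "(z + of_int \<beta>) / of_nat p = of_real (1 / real p) * z + of_real (\<beta> / real p)" for z :: complex
      using p0 by (simp add: field_simps)
    with \<beta> show ?thesis
      using False p0 by (intro exI[of _ "1 / real p ^ 12"] exI[of _ "1 / real p"] exI[of _ "\<beta> / real p"])
        (simp add: power_divide)
  qed
  then obtain C \<alpha> \<beta> where C: "C > 0" and \<alpha>: "\<alpha> = (if int p dvd A $ 2 $ 1 then real p else 1 / real p)"
    and eq: "\<And>z. Im z > 0 \<Longrightarrow> norm_delta (of_nat p * moebius_act A z) = C * norm (J z) ^ 12 *
      norm_delta (of_real \<alpha> * z + of_real \<beta>)" by blast
  show thesis
  proof (rule that[of "C powi rp" \<alpha> \<beta>])
    fix z :: complex assume z: "Im z > 0"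
    have J: "norm (J z) \<noteq> 0"
      using moebius_denom_nonzero[OF det z] by (simp add: J_def)
    have nd: "norm_delta (moebius_act A z) = norm (J z) ^ 12 * norm_delta z"
      unfolding J_def moebius_act_def by (rule norm_delta_moebius[OF det z])
    have "norm (slash k (eta_quotient p r1 rp) A z) ^ 24 = (norm (J z) powi (- k)) ^ 24 *
        (norm_delta (moebius_act A z) powi r1 * norm_delta (of_nat p * moebius_act A z) powi rp)"
      using norm_eta_quotient[OF moebius_act_in_upper_half_plane[OF A z], of p r1 rp]
      by (simp add: slash_def norm_mult norm_power_int power_mult_distrib J_def)
    also have "\<dots> = C powi rp * (norm (J z) powi (-24 * k) * norm (J z) powi (12 * r1) * norm (J z) powi (12 * rp)) *
        norm_delta z powi r1 * norm_delta (of_real \<alpha> * z + of_real \<beta>) powi rp"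
      unfolding nd eq[OF z] by (simp add: power_int_mult_distrib power_int_power power_int_power' mult_ac)
    also have "norm (J z) powi (-24 * k) * norm (J z) powi (12 * r1) * norm (J z) powi (12 * rp) =
        norm (J z) powi (12 * (r1 + rp) - 24 * k)"
      using J by (simp add: power_int_add[symmetric] algebra_simps)
    finally show "norm (slash k (eta_quotient p r1 rp) A z) ^ 24 =
      C powi rp * norm (of_int (A $ 2 $ 1) * z + of_int (A $ 2 $ 2)) powi (12 * (r1 + rp) - 24 * k) *
      norm_delta z powi r1 * norm_delta (of_real \<alpha> * z + of_real \<beta>) powi rp"
      by (simp add: J_def)
  qed (use C \<alpha> in auto)
qed

text \<open>The exponential cancels the modulus of the power of q in front of the product,
  \<open>\<beta>\<close> being real. The remaining \<open>qpoch q q\<close>, with q tending to 0,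
  tends to \<open>qpoch 0 0 = 1\<close> by continuity.\<close>

lemma norm_delta_asymp:
  assumes "\<alpha> > 0"
  shows "((\<lambda>z. norm_delta (of_real \<alpha> * z + of_real \<beta>) * exp (2 * pi * \<alpha> * Im z)) \<longlongrightarrow> 1)
    (filtercomap Im at_top)"
proof -
  define w where "w = (\<lambda>z. of_real \<alpha> * z + of_real \<beta> :: complex)"
  have eq: "norm_delta (w z) * exp (2 * pi * \<alpha> * Im z) = norm (qpoch (e2pi (w z)) (e2pi (w z))) ^ 24" for z
  proof -
    have "norm (e2pi (w z / 24)) ^ 24 = exp (- (2 * pi * \<alpha> * Im z))"
      by (simp add: norm_e2pi exp_of_nat_mult[symmetric] w_def)
    then show ?thesis
      by (simp add: norm_delta_def dedekind_eta_eq norm_mult power_mult_distrib exp_minus)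
  qed
  have Im: "filterlim Im at_top (filtercomap Im at_top)" by auto
  have "filterlim (\<lambda>z. 2 * pi * \<alpha> * Im z) at_top (filtercomap Im at_top)"
    using assms by (intro filterlim_tendsto_pos_mult_at_top[OF tendsto_const _ Im]) auto
  then have "((\<lambda>z. exp (- (2 * pi * \<alpha> * Im z))) \<longlongrightarrow> 0) (filtercomap Im at_top)"
    by (intro filterlim_compose[OF exp_at_bot]) (simp add: filterlim_uminus_at_bot)
  then have "((\<lambda>z. norm (e2pi (w z))) \<longlongrightarrow> 0) (filtercomap Im at_top)"
    by (simp add: norm_e2pi w_def mult_ac)
  then have q: "((\<lambda>z. e2pi (w z)) \<longlongrightarrow> 0) (filtercomap Im at_top)"
    by (rule tendsto_norm_zero_cancel)
  have "isCont (\<lambda>q. qpoch q q) 0"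
    using holomorphic_on_imp_continuous_on[OF holomorphic_on_qpoch_self]
    by (auto simp: continuous_on_eq_continuous_at)
  then have "((\<lambda>z. qpoch (e2pi (w z)) (e2pi (w z))) \<longlongrightarrow> qpoch 0 0) (filtercomap Im at_top)"
    by (rule isCont_tendsto_compose) (rule q)
  then have "((\<lambda>z. norm (qpoch (e2pi (w z)) (e2pi (w z))) ^ 24) \<longlongrightarrow> norm (qpoch 0 0 :: complex) ^ 24)
      (filtercomap Im at_top)"
    by (intro tendsto_intros)
  moreover have "qpoch 0 0 = 1" by (simp add: qpoch_def)
  moreover have w: "of_real \<alpha> * z + of_real \<beta> = w z" for z
    by (simp add: w_def)
  ultimately show ?thesis
    unfolding w eq by simp
qed

lemma eta_product_asymp:
  assumes "\<alpha> > 0"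
  shows "((\<lambda>z. norm_delta z powi r1 * norm_delta (of_real \<alpha> * z + of_real \<beta>) powi rp *
    exp (2 * pi * Im z * (real_of_int r1 + \<alpha> * real_of_int rp))) \<longlongrightarrow> 1) (filtercomap Im at_top)"
proof -
  have "((\<lambda>z. (norm_delta z * exp (2 * pi * Im z)) powi r1 *
      (norm_delta (of_real \<alpha> * z + of_real \<beta>) * exp (2 * pi * \<alpha> * Im z)) powi rp) \<longlongrightarrow> 1 powi r1 * 1 powi rp)
      (filtercomap Im at_top)"
    using norm_delta_asymp[of 1 0]
    by (intro tendsto_mult tendsto_power_int norm_delta_asymp assms) auto
  moreover have "(norm_delta z * exp (2 * pi * Im z)) powi r1 *
      (norm_delta w * exp (2 * pi * \<alpha> * Im z)) powi rp = norm_delta z powi r1 * norm_delta w powi rp *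
      exp (2 * pi * Im z * (real_of_int r1 + \<alpha> * real_of_int rp))" for z w
    by (simp add: power_int_mult_distrib exp_power_int exp_add[symmetric] algebra_simps)
  ultimately show ?thesis by simp
qed

lemma filtercomap_Im_at_top_neq_bot [simp]: "filtercomap Im at_top \<noteq> bot"
proof (rule filtercomap_neq_bot_surj)
  show "surj Im" by (rule surjI[of _ "\<lambda>y. Complex 0 y"]) simp
qed simp

lemma eventually_Im_pos: "eventually (\<lambda>z. Im z > 0) (filtercomap Im at_top)"
  by (rule eventually_filtercomapI) (rule eventually_gt_at_top)

lemma tendsto_0_of_mult_exp_Im:
  fixes f :: "complex \<Rightarrow> real"
  assumes "((\<lambda>z. f z * exp (2 * pi * Im z * E)) \<longlongrightarrow> C) (filtercomap Im at_top)" "E > 0"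
  shows "(f \<longlongrightarrow> 0) (filtercomap Im at_top)"
proof -
  have Im: "filterlim Im at_top (filtercomap Im at_top)" by auto
  have "filterlim (\<lambda>z. 2 * pi * E * Im z) at_top (filtercomap Im at_top)"
    using assms(2) by (intro filterlim_tendsto_pos_mult_at_top[OF tendsto_const _ Im]) auto
  then have "((\<lambda>z. exp (- (2 * pi * E * Im z))) \<longlongrightarrow> 0) (filtercomap Im at_top)"
    by (intro filterlim_compose[OF exp_at_bot]) (simp add: filterlim_uminus_at_bot)
  from tendsto_mult[OF assms(1) this] show ?thesis
    by (simp add: exp_minus field_simps)
qed

text \<open>For the right weight the automorphy factor drops out, and the 24th power of the modulus
  is asymptotic to \<open>C * exp (- (2 * pi * Im z * E))\<close>. Thus \<open>E\<close> is 24 times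
  the order at the cusp, measured in q.\<close>

lemma slash_eta_quotient_tendsto_0_iff:
  assumes A: "A \<in> SL2Z" and p: "prime p" and k: "r1 + rp = 2 * k"
  shows "(slash k (eta_quotient p r1 rp) A \<longlongrightarrow> 0) (filtercomap Im at_top) \<longleftrightarrow>
    real_of_int r1 + (if int p dvd A $ 2 $ 1 then real p else 1 / real p) * real_of_int rp > 0"
proof -
  let ?F = "filtercomap Im at_top :: complex filter"
  obtain C \<alpha> \<beta> where C: "C > 0" and \<alpha>: "\<alpha> = (if int p dvd A $ 2 $ 1 then real p else 1 / real p)"
    and eq: "\<And>z. Im z > 0 \<Longrightarrow> norm (slash k (eta_quotient p r1 rp) A z) ^ 24 =
      C * norm (of_int (A $ 2 $ 1) * z + of_int (A $ 2 $ 2)) powi (12 * (r1 + rp) - 24 * k) *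
      norm_delta z powi r1 * norm_delta (of_real \<alpha> * z + of_real \<beta>) powi rp"
    using norm_slash_eta_quotient[OF A p] by metis
  define E where "E = real_of_int r1 + \<alpha> * real_of_int rp"
  define g where "g = (\<lambda>z. norm (slash k (eta_quotient p r1 rp) A z) ^ 24)"
  have \<alpha>0: "\<alpha> > 0" using \<alpha> prime_gt_0_nat[OF p] by simp
  have "((\<lambda>z. C * (norm_delta z powi r1 * norm_delta (of_real \<alpha> * z + of_real \<beta>) powi rp *
      exp (2 * pi * Im z * E))) \<longlongrightarrow> C * 1) ?F"
    unfolding E_def by (intro tendsto_mult tendsto_const eta_product_asymp \<alpha>0)
  moreover have "eventually (\<lambda>z. C * (norm_delta z powi r1 * norm_delta (of_real \<alpha> * z + of_real \<beta>) powi rp *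
      exp (2 * pi * Im z * E)) = g z * exp (2 * pi * Im z * E)) ?F"
    using eventually_Im_pos by eventually_elim (simp add: g_def eq k)
  ultimately have lim: "((\<lambda>z. g z * exp (2 * pi * Im z * E)) \<longlongrightarrow> C) ?F"
    by (simp add: tendsto_cong)
  have "(slash k (eta_quotient p r1 rp) A \<longlongrightarrow> 0) ?F \<longleftrightarrow> (g \<longlongrightarrow> 0) ?F"
  proof
    assume "(slash k (eta_quotient p r1 rp) A \<longlongrightarrow> 0) ?F"
    from tendsto_power[OF tendsto_norm_zero[OF this], of 24] show "(g \<longlongrightarrow> 0) ?F"
      by (simp add: g_def)
  next
    assume "(g \<longlongrightarrow> 0) ?F"
    then have "((\<lambda>z. root 24 (g z)) \<longlongrightarrow> root 24 0) ?F" by (rule tendsto_real_root)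
    moreover have "root 24 (g z) = norm (slash k (eta_quotient p r1 rp) A z)" for z
      unfolding g_def by (rule real_root_power_cancel) auto
    ultimately show "(slash k (eta_quotient p r1 rp) A \<longlongrightarrow> 0) ?F"
      by - (rule tendsto_norm_zero_cancel, simp)
  qed
  also have "\<dots> \<longleftrightarrow> E > 0"
  proof
    assume g: "(g \<longlongrightarrow> 0) ?F"
    show "E > 0"
    proof (rule ccontr)
      assume "\<not> E > 0"
      \<comment> \<open>For \<open>E\<close> at most 0 the exponential is at most 1, so a null limit
        of \<open>g\<close> would contradict the nonzero limit \<open>C\<close>.\<close>
      have "((\<lambda>z. g z * exp (2 * pi * Im z * E)) \<longlongrightarrow> 0) ?F"
      proof (rule Lim_null_comparison[OF _ g])
        show "eventually (\<lambda>z. norm (g z * exp (2 * pi * Im z * E)) \<le> g z) ?F"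
          using eventually_Im_pos
        proof eventually_elim
          case (elim z)
          then have "2 * pi * Im z * E \<le> 0"
            using \<open>\<not> E > 0\<close> by (intro mult_nonneg_nonpos) auto
          then show ?case
            by (simp add: g_def mult_left_le)
        qed
      qed
      with lim have "C = 0" using tendsto_unique[OF filtercomap_Im_at_top_neq_bot] by blast
      with C show False by simp
    qed
  next
    assume "E > 0"
    with lim show "(g \<longlongrightarrow> 0) ?F" by (rule tendsto_0_of_mult_exp_Im)
  qed
  finally show ?thesis by (simp add: E_def \<alpha>)
qed

section \<open>Eta quotients that are cusp forms\<close>

lemma holomorphic_on_dedekind_eta: "dedekind_eta holomorphic_on upper_half_plane"
proof -
  have "(\<lambda>z. qpoch (e2pi z) (e2pi z)) holomorphic_on upper_half_plane"
  proof (rule holomorphic_on_compose_gen[OF _ holomorphic_on_qpoch_self, unfolded o_def])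
    show "e2pi holomorphic_on upper_half_plane"
      unfolding e2pi_def by (intro holomorphic_intros)
  qed (auto simp: upper_half_plane_def norm_e2pi_less_1)
  then have "(\<lambda>z. e2pi (z / 24) * qpoch (e2pi z) (e2pi z)) holomorphic_on upper_half_plane"
    by (intro holomorphic_intros) auto
  then show ?thesis by (simp add: dedekind_eta_eq[abs_def])
qed

lemma holomorphic_on_eta_quotient:
  assumes "p > 0"
  shows "eta_quotient p r1 rp holomorphic_on upper_half_plane"
proof -
  have "(\<lambda>z. dedekind_eta (of_nat p * z)) holomorphic_on upper_half_plane"
    by (rule holomorphic_on_compose_gen[OF _ holomorphic_on_dedekind_eta, unfolded o_def])
      (use assms in \<open>auto simp: upper_half_plane_def intro!: holomorphic_intros\<close>)
  then have "(\<lambda>z. dedekind_eta z powi r1 * dedekind_eta (of_nat p * z) powi rp) holomorphic_on upper_half_plane"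
    using assms dedekind_eta_nonzero
    by (intro holomorphic_intros holomorphic_on_dedekind_eta) (auto simp: upper_half_plane_def)
  then show ?thesis
    by (rule holomorphic_transform) (simp add: eta_quotient_apply upper_half_plane_def)
qed

lemma eta_quotient_eq_ratio_powers:
  assumes "Im z > 0" and "r1 + int p * rp = 24 * n"
  shows "eta_quotient p r1 rp z =
    (dedekind_eta z ^ 24) powi n * (dedekind_eta (of_nat p * z) / dedekind_eta z ^ p) powi rp"
proof -
  have nz: "dedekind_eta z \<noteq> 0" by (rule dedekind_eta_nonzero) fact
  have "r1 = 24 * n - int p * rp" using assms(2) by simp
  then have "dedekind_eta z powi r1 = (dedekind_eta z ^ 24) powi n / (dedekind_eta z ^ p) powi rp"
    using nz by (simp add: power_int_diff power_int_power)
  then show ?thesis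
    by (simp add: eta_quotient_apply[OF assms(1)] power_int_divide_distrib)
qed

text \<open>The existence of \<open>N\<close> says that 24 divides p^2 - 1 = 4 m (m + 1). The factor
  3 lies in \<open>m\<close> or \<open>m + 1\<close>, since \<open>m mod 3 = 1\<close> would make
  \<open>p\<close> divisible by 3.\<close>

lemma prime_gt_3_odd_decomp:
  assumes "prime p" "p > (3::nat)"
  obtains m N where "p = 2 * m + 1" "m * (m + 1) = 6 * N"
proof -
  have "\<not> 2 dvd p" "\<not> 3 dvd p" using assms by (auto simp: prime_nat_iff)
  then obtain m where m: "p = 2 * m + 1" by (metis oddE)
  have "m mod 3 = 0 \<or> m mod 3 = 2" using \<open>\<not> 3 dvd p\<close> unfolding m by presburger
  then have "3 dvd m * (m + 1)"
  proof
    assume "m mod 3 = 2"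
    then have "3 dvd m + 1" by presburger
    then show ?thesis by (rule dvd_mult)
  qed (simp add: mod_eq_0_iff_dvd)
  moreover have "2 dvd m * (m + 1)" by simp
  moreover have "coprime 2 (3::nat)" by simp
  ultimately have "2 * 3 dvd m * (m + 1)" by (metis divides_mult)
  then obtain N where "m * (m + 1) = 6 * N" by (auto elim: dvdE)
  with m that show thesis by blast
qed

lemma slash_eta_quotient_Gamma1:
  assumes p: "prime p" "p > 3" and k: "r1 + rp = 2 * k" and n: "r1 + int p * rp = 24 * n"
    and A: "A \<in> Gamma1 p" and z: "Im z > 0"
  shows "slash k (eta_quotient p r1 rp) A z = eta_quotient p r1 rp z"
proof -
  obtain m N where m: "p = 2 * m + 1" "m * (m + 1) = 6 * N"
    using prime_gt_3_odd_decomp[OF p] .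
  have SL: "A \<in> SL2Z" using A by (simp add: Gamma1_def)
  then have det: "A $ 1 $ 1 * A $ 2 $ 2 - A $ 1 $ 2 * A $ 2 $ 1 = 1" by (simp add: SL2Z_iff)
  have "int p dvd A $ 2 $ 1" "int p dvd A $ 2 $ 2 - 1"
    using A by (auto simp: Gamma1_def cong_iff_dvd_diff)
  then obtain c' d' where c: "A $ 2 $ 1 = int p * c'" and "A $ 2 $ 2 - 1 = int p * d'"
    by (auto elim!: dvdE)
  then have d: "A $ 2 $ 2 = 1 + int p * d'" by simp
  define J where "J = of_int (A $ 2 $ 1) * z + of_int (A $ 2 $ 2)"
  define w where "w = moebius_act A z"
  have w: "Im w > 0" unfolding w_def by (rule moebius_act_in_upper_half_plane[OF SL z])
  have J: "J \<noteq> 0" unfolding J_def by (rule moebius_denom_nonzero[OF det z])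
  have k': "k = 12 * n - int m * rp" using k n by (simp add: m algebra_simps)
  have delta: "dedekind_eta w ^ 24 = J ^ 12 * dedekind_eta z ^ 24"
    unfolding w_def moebius_act_def J_def by (rule dedekind_eta_power24_moebius[OF det z])
  have ratio: "dedekind_eta (of_nat p * w) / dedekind_eta w ^ p =
      dedekind_eta (of_nat p * z) / dedekind_eta z ^ p / J ^ m"
    unfolding w_def moebius_act_def J_def by (rule dedekind_eta_ratio_Gamma1[OF det z m c d])
  have "eta_quotient p r1 rp w = (J ^ 12) powi n / (J ^ m) powi rp * eta_quotient p r1 rp z"
    unfolding eta_quotient_eq_ratio_powers[OF w n] eta_quotient_eq_ratio_powers[OF z n] delta ratio
    by (simp add: power_int_mult_distrib power_int_divide_distrib mult_ac)
  also have "(J ^ 12) powi n / (J ^ m) powi rp = J powi k"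
    using J by (simp add: power_int_power power_int_diff k')
  finally show ?thesis
    using J by (simp add: slash_def w_def[symmetric] J_def[symmetric] power_int_minus)
qed

definition mat22 :: "int \<Rightarrow> int \<Rightarrow> int \<Rightarrow> int \<Rightarrow> int ^ 2 ^ 2"
  where "mat22 a b c d = vector [vector [a, b], vector [c, d]]"

lemma mat22_nth [simp]:
  "mat22 a b c d $ 1 $ 1 = a" "mat22 a b c d $ 1 $ 2 = b"
  "mat22 a b c d $ 2 $ 1 = c" "mat22 a b c d $ 2 $ 2 = d"
  by (simp_all add: mat22_def)

lemma e2pi_power_int: "e2pi z powi n = e2pi (of_int n * z)"
  unfolding e2pi_def exp_power_int by (simp add: mult_ac)

text \<open>The weight is recovered from invariance alone: moduli are compared at the point
  \<open>\<i>\<close> for the matrix (1, 0; p, 1), where \<open>norm J > 1\<close> makes the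
  exponent of \<open>norm J\<close> unique.\<close>

lemma weight_of_eta_quotient:
  assumes p: "p > 1" and inv: "\<And>A z. A \<in> Gamma1 p \<Longrightarrow> Im z > 0 \<Longrightarrow>
    slash k (eta_quotient p r1 rp) A z = eta_quotient p r1 rp z"
  shows "r1 + rp = 2 * k"
proof -
  define A where "A = mat22 1 0 (int p) 1"
  define J where "J = of_nat p * \<i> + (1::complex)"
  define w where "w = moebius_act A \<i>"
  let ?f = "eta_quotient p r1 rp"
  have A: "A \<in> Gamma1 p" by (simp add: A_def Gamma1_def SL2Z_iff cong_def)
  then have w: "Im w > 0" unfolding w_def by (intro moebius_act_in_upper_half_plane) (auto simp: Gamma1_def)
  have wJ: "w = \<i> / J" by (simp add: w_def A_def moebius_act_def J_def)
  have "norm J ^ 2 > 1"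
    using p by (simp add: J_def cmod_power2)
  then have J: "norm J > 1"
    by (metis norm_ge_zero not_less one_power2 power_mono)
  have J0: "J \<noteq> 0" using J by auto
  have f0: "?f \<i> \<noteq> 0" using p by (intro eta_quotient_nonzero) auto
  have "J powi (- k) * ?f w = ?f \<i>"
    using inv[OF A, of \<i>] by (simp add: slash_def w_def) (simp add: A_def J_def)
  then have "?f w = J powi k * ?f \<i>"
    using J0 by (simp add: power_int_minus field_simps)
  then have "norm (?f w) ^ 24 = norm J powi (24 * k) * norm (?f \<i>) ^ 24"
    by (simp add: norm_mult norm_power_int power_mult_distrib power_int_power' mult.commute)
  moreover have "norm (?f w) ^ 24 = norm J powi (12 * (r1 + rp)) * norm (?f \<i>) ^ 24"
  proof -
    have 1: "norm_delta w = norm J ^ 12 * norm_delta \<i>"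
      using norm_delta_moebius[of 1 1 0 "int p" \<i>] by (simp add: wJ J_def)
    have 2: "norm_delta (of_nat p * w) = norm J ^ 12 * norm_delta (of_nat p * \<i>)"
      using norm_delta_p_moebius_dvd[of 1 1 0 "int p" \<i> p] p by (simp add: wJ J_def)
    have "norm J powi (12 * (r1 + rp)) = (norm J ^ 12) powi r1 * (norm J ^ 12) powi rp"
      using J0 by (simp add: power_int_power power_int_add ring_distribs)
    then show ?thesis
      by (simp add: norm_eta_quotient[OF w] norm_eta_quotient[of \<i>] 1 2 power_int_mult_distrib)
  qed
  ultimately have "norm J powi (24 * k) = norm J powi (12 * (r1 + rp))"
    using f0 by simp
  then have "24 * k = 12 * (r1 + rp)"
    using power_int_strict_increasing[OF _ J] by (metis less_irrefl linorder_neqE)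
  then show ?thesis by simp
qed

text \<open>Translation by 1 has trivial automorphy factor and multiplies the quotient by
  \<open>e2pi (of_int (r1 + int p * rp) / 24)\<close>, which must be 1 as the quotient has no
  zeros.\<close>

lemma eta_quotient_translate_dvd:
  assumes p: "p > 0" and inv: "\<And>A z. A \<in> Gamma1 p \<Longrightarrow> Im z > 0 \<Longrightarrow>
    slash k (eta_quotient p r1 rp) A z = eta_quotient p r1 rp z"
  shows "24 dvd r1 + int p * rp"
proof -
  let ?f = "eta_quotient p r1 rp"
  have "mat22 1 1 0 1 \<in> Gamma1 p" by (simp add: Gamma1_def SL2Z_iff)
  from inv[OF this, of \<i>] have "?f (\<i> + 1) = ?f \<i>"
    by (simp add: slash_def moebius_act_def)
  moreover have "?f (\<i> + 1) = e2pi (of_int (r1 + int p * rp) / 24) * ?f \<i>"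
  proof -
    have "dedekind_eta (of_nat p * (\<i> + 1)) = e2pi (of_nat p / 24) * dedekind_eta (of_nat p * \<i>)"
      using dedekind_eta_plus_nat[of "of_nat p * \<i>" p] by (simp add: ring_distribs)
    moreover have "e2pi (of_int (r1 + int p * rp) / 24) = e2pi (1 / 24) powi r1 * e2pi (of_nat p / 24) powi rp"
      by (simp add: e2pi_power_int e2pi_add[symmetric] add_divide_distrib mult_ac)
    ultimately show ?thesis
      using dedekind_eta_plus_1[of \<i>] by (simp add: eta_quotient_apply power_int_mult_distrib)
  qed
  ultimately have "e2pi (of_int (r1 + int p * rp) / 24) = 1"
    using eta_quotient_nonzero[of \<i> p r1 rp] p by simp
  then obtain l where "of_int (r1 + int p * rp) / 24 = (of_int l :: complex)"
    by (auto simp: e2pi_eq_1_iff elim: Ints_cases)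
  then have "(of_int (r1 + int p * rp) :: complex) = of_int (24 * l)"
    by (simp add: field_simps)
  then have "r1 + int p * rp = 24 * l" by (simp only: of_int_eq_iff)
  then show ?thesis by simp
qed

text \<open>The conditions express, in this order, the weight, the invariance under translation, and
  the vanishing at the cusps \<infinity> and 0.\<close>

theorem eta_quotient_cusp_form_iff:
  assumes p: "prime p" "p > 3"
  shows "eta_quotient p r1 rp \<in> cusp_forms k (Gamma1 p) \<longleftrightarrow>
    r1 + rp = 2 * k \<and> 24 dvd r1 + int p * rp \<and> r1 + int p * rp > 0 \<and> int p * r1 + rp > 0"
    (is "?L \<longleftrightarrow> ?R")
proof -
  have pos_iff: "real_of_int r1 + (if b then real p else 1 / real p) * real_of_int rp > 0 \<longleftrightarrow>
      (if b then r1 + int p * rp > 0 else int p * r1 + rp > 0)" for b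
  proof -
    have 1: "real_of_int r1 + 1 / real p * real_of_int rp = real_of_int (int p * r1 + rp) / real p"
      using p by (simp add: field_simps)
    have 2: "real_of_int r1 + real p * real_of_int rp = real_of_int (r1 + int p * rp)" by simp
    show ?thesis
    proof (cases b)
      case True
      then show ?thesis by (simp only: if_True 2 of_int_0_less_iff)
    next
      case False
      then show ?thesis
        by (simp only: if_False 1 zero_less_divide_iff of_int_0_less_iff) (use p in auto)
    qed
  qed
  show ?thesis
  proof
    assume L: ?L
    have inv: "slash k (eta_quotient p r1 rp) A z = eta_quotient p r1 rp z"
      if "A \<in> Gamma1 p" "Im z > 0" for A z
      using L that by (auto simp: cusp_forms_def upper_half_plane_def)
    have k: "r1 + rp = 2 * k" by (rule weight_of_eta_quotient[OF _ inv]) (use p in auto)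
    have lim: "(slash k (eta_quotient p r1 rp) A \<longlongrightarrow> 0) (filtercomap Im at_top)" if "A \<in> SL2Z" for A
      using L that by (auto simp: cusp_forms_def)
    \<comment> \<open>The identity and the inversion represent the two kinds of cusps: their lower
      left entries are 0 and 1.\<close>
    have "mat22 1 0 0 1 \<in> SL2Z" "mat22 0 (-1) 1 0 \<in> SL2Z" by (simp_all add: SL2Z_iff)
    from this[THEN lim] have "r1 + int p * rp > 0" "int p * r1 + rp > 0"
      using p pos_iff[of True] pos_iff[of False]
      by (simp_all add: slash_eta_quotient_tendsto_0_iff[OF _ p(1) k] SL2Z_iff)
    with k eta_quotient_translate_dvd[OF _ inv] p show ?R by auto
  next
    assume R: ?R
    then obtain n where n: "r1 + int p * rp = 24 * n" by blast
    have "eta_quotient p r1 rp \<in> extensional upper_half_plane" by (simp add: eta_quotient_def)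
    moreover have "slash k (eta_quotient p r1 rp) A z = eta_quotient p r1 rp z"
      if "A \<in> Gamma1 p" "z \<in> upper_half_plane" for A z
      using that R by (intro slash_eta_quotient_Gamma1[OF p _ n]) (auto simp: upper_half_plane_def)
    moreover have "(slash k (eta_quotient p r1 rp) A \<longlongrightarrow> 0) (filtercomap Im at_top)" if "A \<in> SL2Z" for A
      using R that by (subst slash_eta_quotient_tendsto_0_iff[OF _ p(1)]) (auto simp: pos_iff)
    moreover have "eta_quotient p r1 rp holomorphic_on upper_half_plane"
      using p by (intro holomorphic_on_eta_quotient) auto
    ultimately show ?L by (simp add: cusp_forms_def)
  qed
qed

text \<open>The order at \<infinity> can be read off the function. If the left side were larger, the
  common 24th power of the modulus times the exponential for the right side would tend both to 0 and
  to 1.\<close>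

lemma eta_quotient_order_at_infinity:
  assumes p: "p > 0" and eq: "eta_quotient p r1 rp = eta_quotient p s1 sp"
  shows "r1 + int p * rp \<le> s1 + int p * sp"
proof (rule ccontr)
  assume "\<not> ?thesis"
  then have E: "real_of_int (r1 + int p * rp) - real_of_int (s1 + int p * sp) > 0"
    by (simp only: not_le diff_gt_0_iff_gt of_int_less_iff)
  define f where "f = (\<lambda>r1 rp z. norm_delta z powi r1 * norm_delta (of_nat p * z) powi rp)"
  have lim: "((\<lambda>z. f r1 rp z * exp (2 * pi * Im z * real_of_int (r1 + int p * rp))) \<longlongrightarrow> 1)
      (filtercomap Im at_top)" for r1 rp
    using eta_product_asymp[of "real p" r1 0 rp] p by (simp add: f_def)
  define g where "g = (\<lambda>z. f r1 rp z * exp (2 * pi * Im z * real_of_int (s1 + int p * sp)))"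
  have "((\<lambda>z. g z * exp (2 * pi * Im z * (real_of_int (r1 + int p * rp) - real_of_int (s1 + int p * sp)))) \<longlongrightarrow> 1)
      (filtercomap Im at_top)"
    using lim[of r1 rp] by (simp add: g_def mult.assoc exp_add[symmetric] right_diff_distrib)
  then have "(g \<longlongrightarrow> 0) (filtercomap Im at_top)"
    using E by (rule tendsto_0_of_mult_exp_Im)
  moreover have "(g \<longlongrightarrow> 1) (filtercomap Im at_top)"
  proof -
    have "eventually (\<lambda>z. f s1 sp z * exp (2 * pi * Im z * real_of_int (s1 + int p * sp)) = g z)
        (filtercomap Im at_top)"
      using eventually_Im_pos
    proof eventually_elim
      case (elim z)
      then have "f r1 rp z = f s1 sp z"
        unfolding f_def norm_eta_quotient[OF elim, symmetric] eq by simp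
      then show ?case by (simp add: g_def)
    qed
    with lim[of s1 sp] show ?thesis by (rule Lim_transform_eventually)
  qed
  ultimately show False
    using tendsto_unique[OF filtercomap_Im_at_top_neq_bot] by fastforce
qed

section \<open>Counting\<close>

text \<open>As \<open>k\<close> is a multiple of \<open>h_of p\<close>, this makes k (p + 1) / 12 an
  integer.\<close>

lemma h_of_mult_Suc_dvd:
  assumes "prime p" "p > (3::nat)"
  shows "12 dvd h_of p * (p + 1)"
proof -
  have "\<not> 2 dvd p" "\<not> 3 dvd p"
    using assms by (auto simp: prime_nat_iff)
  then have "p mod 24 = 1 \<or> p mod 24 = 5 \<or> p mod 24 = 7 \<or> p mod 24 = 11 \<or>
      p mod 24 = 13 \<or> p mod 24 = 17 \<or> p mod 24 = 19 \<or> p mod 24 = 23"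
    by presburger
  moreover define m r where "m = p div 24" and "r = p mod 24"
  moreover have "h * (p + 1) = 24 * (h * m) + h * (r + 1)" for h
  proof -
    have "p = 24 * m + r" by (simp add: m_def r_def)
    then show ?thesis by (simp add: algebra_simps)
  qed
  ultimately show ?thesis
    by (elim disjE) (simp_all add: h_of_def)
qed

text \<open>Coprimality provides an integer solution, and \<open>red\<close> moves any solution to a
  natural number below \<open>d\<close>. Applied to the least solution itself, \<open>red\<close>
  gives the bound.\<close>

lemma least_rep:
  assumes d: "d > 0" and coprime: "coprime (12 div h) d"
  shows "[int (12 div h) * int (least_rep h d k') = k'] (mod int d)" "least_rep h d k' < d"
proof -
  let ?P = "\<lambda>c. [int (12 div h) * int c = k'] (mod int d)"
  have red: "?P (nat (x mod int d))" if "[int (12 div h) * x = k'] (mod int d)" for x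
  proof -
    have "[int (12 div h) * (x mod int d) = int (12 div h) * x] (mod int d)"
      by (simp add: cong_def mod_mult_right_eq)
    then show ?thesis using that d cong_trans by auto
  qed
  obtain y where "[int (12 div h) * y = 1] (mod int d)"
    using cong_solve_coprime_int[of "int (12 div h)" "int d"] coprime by auto
  then have "[int (12 div h) * (y * k') = k'] (mod int d)"
    using cong_scalar_right[of "int (12 div h) * y" 1 "int d" k'] by (simp add: mult.assoc)
  from LeastI[of ?P, OF red[OF this]] show P: "?P (least_rep h d k')"
    by (simp add: least_rep_def)
  have "least_rep h d k' \<le> nat (int (least_rep h d k') mod int d)"
    unfolding least_rep_def[of h d k'] by (rule Least_le) (rule red[OF P, unfolded least_rep_def])
  also have "\<dots> < d" using d by (simp add: nat_less_iff)
  finally show "least_rep h d k' < d" .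
qed

lemma card_residue_class_interval:
  fixes c d N lo hi :: int
  assumes d: "d > 0" and "\<And>j. 0 < c + d * j \<and> c + d * j < N \<longleftrightarrow> lo \<le> j \<and> j < hi"
  shows "card {n. 0 < n \<and> n < N \<and> [n = c] (mod d)} = nat (hi - lo)"
proof -
  have "{n. 0 < n \<and> n < N \<and> [n = c] (mod d)} = (\<lambda>j. c + d * j) ` {lo..<hi}"
  proof safe
    fix n assume n: "0 < n" "n < N" "[n = c] (mod d)"
    then obtain j where "n = c + d * j" by (metis cong_iff_lin cong_sym mult.commute)
    with n assms(2)[of j] show "n \<in> (\<lambda>j. c + d * j) ` {lo..<hi}" by auto
  qed (use assms(2) in \<open>auto simp: cong_def\<close>)
  moreover have "inj_on (\<lambda>j. c + d * j) {lo..<hi}" using d by (auto intro: inj_onI)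
  ultimately show ?thesis by (simp add: card_image)
qed

text \<open>The parameter \<open>n\<close> is the order at \<infinity>. It determines
  \<open>rp\<close> through k = 12 n - m rp and then \<open>r1\<close> through the weight. The
  inequalities are positivity of the orders at the two cusps, and the divisibility is integrality of
  \<open>rp\<close>.\<close>

lemma bij_betw_eta_quotients:
  fixes p m :: nat and k :: int
  assumes p: "prime p" "p > 3" and m: "p = 2 * m + 1"
  defines "\<phi> \<equiv> \<lambda>n. eta_quotient p (2 * k - (12 * n - k) div int m) ((12 * n - k) div int m)"
  shows "bij_betw \<phi> {n. 0 < n \<and> 12 * n < k * (int p + 1) \<and> int m dvd 12 * n - k}
    (eta_quotients p \<inter> cusp_forms k (Gamma1 p))"
proof (rule bij_betw_imageI)
  let ?B = "{n. 0 < n \<and> 12 * n < k * (int p + 1) \<and> int m dvd 12 * n - k}"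
  have m0: "m > 0" using p m by simp
  have orders: "2 * k - r + int p * r = 24 * n" "int p * (2 * k - r) + r = 2 * (k * (int p + 1) - 12 * n)"
    if "12 * n - k = int m * r" for n r
    using that by (simp_all add: m algebra_simps)
  have r: "12 * n - k = int m * ((12 * n - k) div int m)" if "n \<in> ?B" for n
    using that by auto
  show "inj_on \<phi> ?B"
  proof (rule inj_onI)
    have *: "n \<le> n'" if "n \<in> ?B" "n' \<in> ?B" "\<phi> n = \<phi> n'" for n n'
      using eta_quotient_order_at_infinity[OF _ that(3)[unfolded \<phi>_def]] p
      unfolding orders(1)[OF r[OF that(1)]] orders(1)[OF r[OF that(2)]] by simp
    show "n = n'" if "n \<in> ?B" "n' \<in> ?B" "\<phi> n = \<phi> n'" for n n'
      using *[OF that] *[OF that(2,1) that(3)[symmetric]] by simp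
  qed
  show "\<phi> ` ?B = eta_quotients p \<inter> cusp_forms k (Gamma1 p)"
  proof safe
    fix n assume n: "0 < n" "12 * n < k * (int p + 1)" "int m dvd 12 * n - k"
    show "\<phi> n \<in> eta_quotients p" by (auto simp: \<phi>_def eta_quotients_def)
    have "n \<in> ?B" using n by simp
    note o = orders[OF r[OF this]]
    show "\<phi> n \<in> cusp_forms k (Gamma1 p)"
      unfolding \<phi>_def eta_quotient_cusp_form_iff[OF p] o using n by simp
  next
    fix f assume "f \<in> eta_quotients p" and f: "f \<in> cusp_forms k (Gamma1 p)"
    then obtain r1 rp where f_eq: "f = eta_quotient p r1 rp" by (auto simp: eta_quotients_def)
    have R: "r1 + rp = 2 * k" "24 dvd r1 + int p * rp" "r1 + int p * rp > 0" "int p * r1 + rp > 0"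
      using f unfolding f_eq eta_quotient_cusp_form_iff[OF p] by auto
    then obtain n where n: "r1 + int p * rp = 24 * n" by blast
    have r1: "r1 = 2 * k - rp" using R(1) by simp
    have eq: "12 * n - k = int m * rp" using n by (simp add: r1 m algebra_simps)
    then have rp: "(12 * n - k) div int m = rp" using m0 by simp
    have "n \<in> ?B"
      using R(3,4) orders[OF eq] eq by (simp add: r1)
    moreover have "f = \<phi> n" by (simp add: f_eq \<phi>_def rp r1)
    ultimately show "f \<in> \<phi> ` ?B" by blast
  qed
qed

theorem theorem5p2:
  fixes p h d c :: nat and k k' :: int
  assumes "prime p" and "p > 3"
    and "h = h_of p"
    and "k' > 0" and "k = int h * k'"
    and "p - 1 = 2 * h * d"
    and "c = least_rep h d k'"
  shows "finite (eta_quotients p \<inter> cusp_forms k (Gamma1 p)) \<and>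
    (real c = of_int k * (real p + 1) / 12 - of_int \<lfloor>of_int k * (real p + 1) / (12 * real d)\<rfloor> * real d \<longrightarrow>
      real (card (eta_quotients p \<inter> cusp_forms k (Gamma1 p))) = of_int k * (real p + 1) / (12 * real d) - 1) \<and>
    (real c < of_int k * (real p + 1) / 12 - of_int \<lfloor>of_int k * (real p + 1) / (12 * real d)\<rfloor> * real d \<longrightarrow>
      int (card (eta_quotients p \<inter> cusp_forms k (Gamma1 p))) = \<lceil>of_int k * (real p + 1) / (12 * real d)\<rceil>) \<and>
    (real c > of_int k * (real p + 1) / 12 - of_int \<lfloor>of_int k * (real p + 1) / (12 * real d)\<rfloor> * real d \<longrightarrow>
      int (card (eta_quotients p \<inter> cusp_forms k (Gamma1 p))) = \<lfloor>of_int k * (real p + 1) / (12 * real d)\<rfloor>)"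
proof -
  let ?S = "eta_quotients p \<inter> cusp_forms k (Gamma1 p)"
  define g where "g = int (12 div h)"
  have h: "h dvd 12" "coprime (12 div h) d"
    using h_of_dvd_12_coprime[OF assms(1,2)] assms(3,6) by auto
  have h0: "h > 0" using h(1) by (auto intro: Nat.gr0I)
  have hg: "int h * g = 12"
    using h(1) by (simp add: g_def flip: of_nat_mult)
  have p: "p = 2 * (h * d) + 1" using assms(2,6) by simp
  then have d0: "d > 0" using assms(2) by (auto intro: Nat.gr0I)
  have c: "[g * int c = k'] (mod int d)" "c < d"
    using least_rep[OF d0 h(2), of k'] by (auto simp: assms(7) g_def)
  have cop: "coprime g (int d)" using h(2) by (simp add: g_def)
  obtain l where l: "h * (p + 1) = 12 * l"
    using h_of_mult_Suc_dvd[OF assms(1,2)] assms(3) by (auto elim: dvdE)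
  define N where "N = k' * int l"
  have N: "k * (int p + 1) = 12 * N"
  proof -
    have "int h * (int p + 1) = 12 * int l" using arg_cong[OF l, of int] by (simp add: ring_distribs)
    then show ?thesis by (simp add: N_def assms(5) mult_ac)
  qed
  have N0: "N > 0"
  proof -
    have "k > 0" using assms(4,5) h0 by simp
    then have "12 * N > 0" unfolding N[symmetric] by simp
    then show ?thesis by simp
  qed
  have "int h * (g * N) = int h * (k' * (int p + 1))"
    using N hg by (simp add: assms(5) algebra_simps)
  then have gN: "g * N = k' * (int p + 1)" using h0 by simp
  \<comment> \<open>Multiplied by \<open>g\<close>, both sides are congruent to 2 k', since
    \<open>p\<close> is 1 modulo \<open>d\<close> and \<open>g * int c\<close> is congruent to
    \<open>k'\<close>; the unit \<open>g\<close> is then cancelled.\<close>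
  have N2c: "[N = 2 * int c] (mod int d)"
  proof -
    have "g * N - 2 * k' = int d * (2 * int h * k')" unfolding gN by (simp add: p algebra_simps)
    then have "[g * N = 2 * k'] (mod int d)" by (simp add: cong_iff_dvd_diff)
    moreover have "[2 * k' = g * (2 * int c)] (mod int d)"
      using cong_scalar_left[OF cong_sym[OF c(1)], of 2] by (simp add: mult_ac)
    ultimately have "[g * N = g * (2 * int c)] (mod int d)" by (rule cong_trans)
    then show ?thesis using cong_mult_lcancel[OF cop] by blast
  qed
  \<comment> \<open>Both 12 and \<open>k\<close> contain the factor \<open>h\<close>. Once it is
    divided out, \<open>g * n\<close> has to be congruent to \<open>k'\<close>, and the solutions
    form the class of \<open>c\<close>.\<close>
  have B: "{n. 0 < n \<and> 12 * n < k * (int p + 1) \<and> int (h * d) dvd 12 * n - k} =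
      {n. 0 < n \<and> n < N \<and> [n = int c] (mod int d)}"
  proof -
    have "int (h * d) dvd 12 * n - k \<longleftrightarrow> [n = int c] (mod int d)" for n
    proof -
      have "12 * n - k = int h * (g * n - k')"
        by (simp add: assms(5) hg[symmetric] algebra_simps)
      then have "int (h * d) dvd 12 * n - k \<longleftrightarrow> [g * n = k'] (mod int d)"
        using h0 by (simp add: cong_iff_dvd_diff)
      also have "\<dots> \<longleftrightarrow> [g * n = g * int c] (mod int d)"
        using c(1) cong_sym cong_trans by blast
      also have "\<dots> \<longleftrightarrow> [n = int c] (mod int d)" by (rule cong_mult_lcancel[OF cop])
      finally show ?thesis .
    qed
    then show ?thesis unfolding N by auto
  qed
  have bij: "\<exists>\<phi>. bij_betw \<phi> {n. 0 < n \<and> n < N \<and> [n = int c] (mod int d)} ?S"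
    using bij_betw_eta_quotients[OF assms(1,2) p, of k] unfolding B by blast
  have "finite {n. 0 < n \<and> n < N \<and> [n = int c] (mod int d)}"
    by (rule finite_subset[of _ "{0<..<N}"]) auto
  with bij have fin: "finite ?S" using bij_betw_finite by blast
  have card: "card ?S = card {n. 0 < n \<and> n < N \<and> [n = int c] (mod int d)}"
    using bij bij_betw_same_card by metis
  define q r where "q = N div int d" and "r = N mod int d"
  have qr: "N = int d * q + r" "0 \<le> r" "r < int d" using d0 by (simp_all add: q_def r_def)
  have q0: "q \<ge> 0" using N0 d0 by (simp add: q_def pos_imp_zdiv_nonneg_iff)
  have real1: "of_int k * (real p + 1) / 12 = real_of_int N"
    using arg_cong[OF N, of real_of_int] by simp
  have real2: "of_int k * (real p + 1) / (12 * real d) = real_of_int N / real d"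
    using real1 by (simp add: field_simps)
  have floor: "\<lfloor>real_of_int N / real d\<rfloor> = q"
    using floor_divide_of_int_eq[of N "int d"] by (simp add: q_def)
  have rem: "real_of_int N - real_of_int q * real d = real_of_int r"
    using arg_cong[OF qr(1), of real_of_int] by (simp add: mult.commute)
  have less: "int d * x + int d \<le> int d * y" if "x < y" for x y :: int
    using mult_left_mono[of "x + 1" y "int d"] that by (simp add: algebra_simps)
  then have neg: "int d * j + int d \<le> 0" if "j < 0" for j
    using less[OF that] by simp
  have nonneg: "0 \<le> int d * j" if "0 \<le> j" for j
    using that by simp
  \<comment> \<open>Facts on the nonlinear terms \<open>int d * j\<close> and
    \<open>int d * q\<close> from which linear arithmetic can find the range of
    \<open>j\<close>.\<close>
  have bounds: "j < 0 \<longrightarrow> int d * j + int d \<le> 0" "0 \<le> j \<longrightarrow> 0 \<le> int d * j"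
    "j < q \<longrightarrow> int d * j + int d \<le> int d * q" "q < j \<longrightarrow> int d * q + int d \<le> int d * j"
    "j = q \<longrightarrow> int d * j = int d * q" for j
    using neg nonneg less by auto
  \<comment> \<open>By \<open>N2c\<close>, \<open>r\<close> is congruent to 2 c. So c = r makes c
    divisible by d, and c = 0 makes r divisible by d, while both lie in [0, d).\<close>
  have zero: "c = 0 \<and> r = 0" if "int c = r \<or> c = 0"
  proof -
    have small: "x = 0" if "int d dvd x" "0 \<le> x" "x < int d" for x
      using zdvd_not_zless[of x "int d"] that by linarith
    have "[r = 2 * int c] (mod int d)" using N2c by (simp add: r_def)
    then have dvd: "int d dvd r - 2 * int c" by (simp add: cong_iff_dvd_diff)
    from that have "c = 0"
    proof
      assume "int c = r"
      then show ?thesis using dvd c(2) small[of "int c"] by simp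
    qed
    with dvd qr(2,3) small[of r] show ?thesis by simp
  qed
  show ?thesis
    unfolding real1 real2 floor rem
  proof (intro conjI impI fin)
    assume "real c = real_of_int r"
    then have "int c = r" by linarith
    then have 0: "c = 0" "r = 0" using zero by auto
    \<comment> \<open>The class consists of the multiples of \<open>d\<close>, and the endpoints 0
      and \<open>N = int d * q\<close> are both excluded.\<close>
    have "card ?S = nat (q - 1)"
      unfolding card using d0 0 qr
      by (intro card_residue_class_interval) (auto simp: zero_less_mult_iff)
    moreover have "q \<ge> 1" using N0 0 qr q0 by (cases "q = 0") auto
    moreover have "real_of_int N / real d = real_of_int q" using 0 qr d0 by simp
    ultimately show "real (card ?S) = real_of_int N / real d - 1" by simp
  next
    assume "real c < real_of_int r"
    then have cr: "int c < r" by linarith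
    then have c0: "c > 0" using zero by (cases "c = 0") auto
    have "card ?S = nat (q + 1 - 0)"
      unfolding card
    proof (rule card_residue_class_interval)
      fix j
      define X Y where "X = int d * j" and "Y = int d * q"
      note bounds[of j, folded X_def Y_def] qr(1)[folded Y_def] qr(2,3)
      then show "0 < int c + int d * j \<and> int c + int d * j < N \<longleftrightarrow> 0 \<le> j \<and> j < q + 1"
        unfolding X_def[symmetric] using c0 cr c(2) q0
        by (cases "j < 0"; cases "j < q"; cases "j = q") auto
    qed (use d0 in simp)
    moreover have "\<lceil>real_of_int N / real d\<rceil> = q + 1"
    proof (rule ceiling_unique)
      show "real_of_int (q + 1) - 1 < real_of_int N / real d"
        using rem cr d0 by (simp add: pos_less_divide_eq)
      show "real_of_int N / real d \<le> real_of_int (q + 1)"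
        using rem qr(3) d0 by (simp add: pos_divide_le_eq algebra_simps)
    qed
    ultimately show "int (card ?S) = \<lceil>real_of_int N / real d\<rceil>" using q0 by simp
  next
    assume "real c > real_of_int r"
    then have cr: "int c > r" by linarith
    \<comment> \<open>Now \<open>j = q\<close> fails because \<open>c\<close> exceeds
      \<open>r\<close>, while \<open>j = 0\<close> remains admissible as \<open>c\<close> is
      positive.\<close>
    have "card ?S = nat (q - 0)"
      unfolding card
    proof (rule card_residue_class_interval)
      fix j
      define X Y where "X = int d * j" and "Y = int d * q"
      note bounds[of j, folded X_def Y_def] qr(1)[folded Y_def] qr(2,3)
      then show "0 < int c + int d * j \<and> int c + int d * j < N \<longleftrightarrow> 0 \<le> j \<and> j < q"
        unfolding X_def[symmetric] using cr c(2) q0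
        by (cases "j < 0"; cases "j < q"; cases "j = q") auto
    qed (use d0 in simp)
    then show "int (card ?S) = q" using q0 by simp
  qed
qed

end
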